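(* Let $\mathbf{O}_0 \Subset \mathbf{O} \subset \mathbb{R}^d$ be concentric open balls with diameters $L_0$ and $L$, respectively. Let $(\omega_\sigma)_{\sigma>0}$ be a sequence of Fock-states that describes a homogeneous proper condensate in $\mathbf{O}$ in the limit, with normalized singular wave function $s$, condensate momentum $\boldsymbol{p}$, condensate particle number $n_C(\sigma)$ and regular occupation bound $n_R$ (all defined in the context). Then, with some numerical constant $C$, the following holds. (i) (Off-diagonal long range order.) For all values of $\sigma$ with $n_C(\sigma)/|\mathbf{O}| > n_R/|\mathbf{O}_0|$ there appear in $\omega_\sigma$ undamped correlations between particles localized in distant translates of $\mathbf{O}_0$ with closure in $\mathbf{O}$, at distances up to $L-L_0$. That is, for every $f \in L^2(\mathbf{O}_0)$ with $\|f\|=1$ and all $\boldsymbol{x},\boldsymbol{y}\in\mathbb{R}^d$ with $\mathbf{O}_0+\boldsymbol{x}\Subset\mathbf{O}$ and $\mathbf{O}_0+\boldsymbol{y}\Subset\mathbf{O}$ (equivalently $|\boldsymbol{x}|,|\boldsymbol{y}|<(L-L_0)/2$, so that $|\boldsymbol{x}-\boldsymbol{y}|<L-L_0$), $$\omega_\sigma\big(a^*(e^{i\boldsymbol{x}\boldsymbol{P}} f)\, a(e^{i\boldsymbol{y}\boldsymbol{P}} f)\big) = \frac{n_C(\sigma)}{|\mathbf{O}|}\, e^{i(\boldsymbol{x}-\boldsymbol{y})\cdot\boldsymbol{p}}\,(2\pi)^d\,|\widetilde{f}(\boldsymbol{p})|^2$$ up to contributions of order $\big(n_R\, n_C(\sigma)\,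 |\mathbf{O}_0|/|\mathbf{O}|\big)^{1/2}$, i.e. up to an error of modulus at most $C \big(n_R\, n_C(\sigma)\, |\mathbf{O}_0|/|\mathbf{O}|\big)^{1/2}$. (ii) (Peak of the momentum distribution.) For all values of $\sigma$ with $n_C(\sigma) > n_R$, the momentum distribution of the particles in $\mathbf{O}$ in the state $\omega_\sigma$ has a peak at the joint momentum $\boldsymbol{p}$ of the particles forming the condensate. That is, for $\boldsymbol{k}\in\mathbb{R}^d$ let $e_{\boldsymbol{k}}(\boldsymbol{x}) = |\mathbf{O}|^{-1/2} e^{i\boldsymbol{x}\cdot\boldsymbol{k}}$ if $\boldsymbol{x}\in\mathbf{O}$ and $e_{\boldsymbol{k}}(\boldsymbol{x})=0$ otherwise; then $$\omega_\sigma\big(a^*(e_{\boldsymbol{k}})\,a(e_{\boldsymbol{k}})\big) = n_C(\sigma)\; d^2\,\big(L|\boldsymbol{k}-\boldsymbol{p}|/2\big)^{-2d}\Big(\int_0^{L|\boldsymbol{k}-\boldsymbol{p}|/2} dr\; r^{d-2}\sin(r)\Big)^2$$ up to contributions of order $(n_R\, n_C(\sigma))^{1/2}$, i.e. up to an error of modulus at most $C(n_R\, n_C(\sigma))^{1/2}$. For $\boldsymbol{k}=\boldsymbol{p}$ the right hand side is understood as its limiting value $n_C(\sigma)$, the number of particles in the condensate.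
   Context: Let $\mathcal{F}$ be the bosonic Fock space over $L^2(\mathbb{R}^d)$, with scalar product $\langle\cdot,\cdot\rangle$ antilinear in the first entry. Annihilation operators $a(f)$ (antilinear in $f$) and creation operators $a^*(g)$ (linear in $g$) satisfy $[a(f),a^*(g)] = \langle f,g\rangle 1$, all other commutators vanishing. A Fock-state is a state $\omega(A) = \mathrm{Tr}\,\rho A$ given by a density matrix $\rho$ on $\mathcal{F}$; it is assumed throughout that $\omega(a^*(f)a(f)) < \infty$ for all $f\in L^2(\mathbb{R}^d)$. A "sequence of states" is a family $(\omega_\sigma)_{\sigma>0}$ of such states. For an open bounded set $\mathbf{O}\subset\mathbb{R}^d$, $|\mathbf{O}|$ is its volume and $L^2(\mathbf{O})\subset L^2(\mathbb{R}^d)$ is the subspace of functions supported in $\mathbf{O}$. The regular subspace $R(\mathbf{O})$ of the sequence is the set of $f\in L^2(\mathbf{O})$ with $\limsup_{\sigma\to\infty}\omega_\sigma(a^*(f)a(f))<\infty$; functions in $L^2(\mathbf{O})\setminus R(\mathbf{O})$ are called singular. The limit of the sequence contains a proper condensate in $\mathbf{O}$ if $R(\mathbf{O})$ is closed and its orthogonal complement in $L^2(\mathbf{O})$ is one-dimensional, spanned by a singular function $s$, $\|s\|=1$ (unique up to a phase). The condensate particle number is $n_C(\sigma) = \omega_\sigma(a^*(s)a(s))$, which is unbounded as $\sigma\to\infty$. The symbol $\lim_\sigma$ is the limit along sequences of $\sigma$ tending to infinity for which $n_C(\sigma)$ diverges. The regular occupation bound $n_R$ is a constant such that, uniformly with regard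 to $\sigma$, $\omega_\sigma(a^*(f)a(f))\le n_R\|f\|^2$ for all $f\in R(\mathbf{O})$. Write $\mathbf{O}_0\Subset\mathbf{O}$ if $\mathbf{O}_0$ is open and its closure is contained in $\mathbf{O}$. $\boldsymbol{P}=-i\nabla$ is the momentum operator on $L^2(\mathbb{R}^d)$, so $(e^{i\boldsymbol{x}\boldsymbol{P}}f)(\boldsymbol{z})=f(\boldsymbol{z}+\boldsymbol{x})$. The sequence describes a homogeneous proper condensate in $\mathbf{O}$ in the limit if its limit contains a proper condensate in $\mathbf{O}$ and $$\lim_\sigma n_C(\sigma)^{-1}\omega_\sigma(a^*(e^{i\boldsymbol{x}\boldsymbol{P}}f)\,a(e^{i\boldsymbol{x}\boldsymbol{P}}g)) = \langle s,f\rangle\langle g,s\rangle$$ for all $\mathbf{O}_0\Subset\mathbf{O}$, all $f,g\in L^2(\mathbf{O}_0)$ and all translations $\boldsymbol{x}\in\mathbb{R}^d$ for which the correspondingly translated region $\mathbf{O}_0-\boldsymbol{x}$, in which $e^{i\boldsymbol{x}\boldsymbol{P}}f$ and $e^{i\boldsymbol{x}\boldsymbol{P}}g$ are supported, satisfies $\mathbf{O}_0-\boldsymbol{x}\Subset\mathbf{O}$. In this case $s$ has (up to a phase) the form $s(\boldsymbol{x})=|\mathbf{O}|^{-1/2}e^{i\boldsymbol{x}\cdot\boldsymbol{p}}$ for $\boldsymbol{x}\in\mathbf{O}$ and $s(\boldsymbol{x})=0$ otherwise, for some $\boldsymbol{p}\in\mathbb{R}^d$; this $\boldsymbol{p}$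 is the condensate momentum, i.e. the joint momentum of the particles forming the condensate. Fourier transform: $\widetilde f(\boldsymbol{p}) = (2\pi)^{-d/2}\int e^{-i\boldsymbol{p}\cdot\boldsymbol{x}}f(\boldsymbol{x})\,d\boldsymbol{x}$.
   Formalization: In (ii) the printed closed formula is false for d ≠ 3 (d=1: the coefficient is (sin u/u)², not (Si(u)/u)², u=L|k−p|/2); it is stated for d=3 only, and for all d with coefficient | |O|^{-1}∫_O e^{i(k−p)·x}dx |², which is 1 at k=p. *)

theory Defs
  imports "HOL-Analysis.Analysis"
begin

section \<open>Square integrable functions\<close>

text \<open>Elements of an $L^2$ space are represented by functions; identities between them are meant
  almost everywhere. Inner products are antilinear in the first entry.\<close>

definition L2 :: "'a measure \<Rightarrow> ('a \<Rightarrow> complex) set" where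
  "L2 M = {f \<in> borel_measurable M. integrable M (\<lambda>x. (cmod (f x))\<^sup>2)}"

definition l2_inner :: "'a measure \<Rightarrow> ('a \<Rightarrow> complex) \<Rightarrow> ('a \<Rightarrow> complex) \<Rightarrow> complex" where
  "l2_inner M f g = (LINT x|M. cnj (f x) * g x)"

definition l2_norm :: "'a measure \<Rightarrow> ('a \<Rightarrow> complex) \<Rightarrow> real" where
  "l2_norm M f = sqrt (LINT x|M. (cmod (f x))\<^sup>2)"

type_synonym 'n wave = "real ^ 'n \<Rightarrow> complex"

definition L2_on :: "(real ^ 'n::finite) set \<Rightarrow> 'n wave set" where
  "L2_on U = {f \<in> L2 lborel. AE x in lborel. x \<notin> U \<longrightarrow> f x = 0}"

definition fourier :: "('n::finite) wave \<Rightarrow> 'n wave" where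
  "fourier f k = complex_of_real ((2 * pi) powr (- real CARD('n) / 2)) *
     (LINT x|lborel. cis (- (k \<bullet> x)) * f x)"

text \<open>The unitary $e^{i x P}$, where $P = -i\nabla$.\<close>

definition translate :: "real ^ 'n \<Rightarrow> ('n::finite) wave \<Rightarrow> 'n wave" where
  "translate x f = (\<lambda>z. f (z + x))"

definition compactly_in :: "(real ^ 'n::finite) set \<Rightarrow> (real ^ 'n) set \<Rightarrow> bool" (infix "\<Subset>" 50) where
  "V \<Subset> U \<longleftrightarrow> open V \<and> closure V \<subseteq> U"


section \<open>Bosonic Fock space and Fock states\<close>

text \<open>A vector of the Fock space over $L^2(\mathbf{R}^d)$ is a sequence of symmetric square integrable
  functions; the n-th one depends on n positions, given as a function on \<open>{..<n}\<close>. For \<open>n = 0\<close> the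
  configuration space is a single point of measure 1 (vacuum sector).\<close>

type_synonym 'n fock = "nat \<Rightarrow> (nat \<Rightarrow> real ^ 'n) \<Rightarrow> complex"

definition config :: "nat \<Rightarrow> (nat \<Rightarrow> real ^ 'n::finite) measure" where
  "config n = PiM {..<n} (\<lambda>_. lborel)"

definition fock_space :: "('n::finite) fock set" where
  "fock_space = {\<Phi>. (\<forall>n. \<Phi> n \<in> L2 (config n)) \<and>
     (\<forall>n \<pi>. \<pi> permutes {..<n} \<longrightarrow> (AE x in config n. \<Phi> n (x \<circ> \<pi>) = \<Phi> n x)) \<and>
     summable (\<lambda>n. (l2_norm (config n) (\<Phi> n))\<^sup>2)}"

definition fock_inner :: "('n::finite) fock \<Rightarrow> 'n fock \<Rightarrow> complex" where
  "fock_inner \<Phi> \<Psi> = (\<Sum>n. l2_inner (config n) (\<Phi> n) (\<Psi> n))"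

text \<open>The domain of the annihilation operator \<open>a(f)\<close> consists of the Fock vectors whose image under
  \<^term>\<open>annihilate f\<close> lies again in the Fock space; \<open>a\<^sup>*(f)\<close> is its adjoint.\<close>

definition annihilate :: "('n::finite) wave \<Rightarrow> 'n fock \<Rightarrow> 'n fock" where
  "annihilate f \<Phi> n x = complex_of_real (sqrt (real (Suc n))) *
     (LINT y|lborel. cnj (f y) * \<Phi> (Suc n) (x(n := y)))"

text \<open>A density matrix $\rho = \sum_j w_j |\Psi_j\rangle\langle\Psi_j|$ is given by its eigenvalues
  (nonnegative, with sum 1) and an orthonormal family of eigenvectors. By the spectral theorem
  these are exactly the positive operators of trace 1 on the (separable) Fock space.\<close>

record ('n::finite) density =
  weight :: "nat \<Rightarrow> real"
  eigvec :: "nat \<Rightarrow> 'n fock"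

definition density_matrix :: "('n::finite) density \<Rightarrow> bool" where
  "density_matrix \<rho> \<longleftrightarrow>
     (\<forall>j. weight \<rho> j \<ge> 0) \<and> weight \<rho> sums 1 \<and>
     (\<forall>j. eigvec \<rho> j \<in> fock_space) \<and>
     (\<forall>i j. fock_inner (eigvec \<rho> i) (eigvec \<rho> j) = (if i = j then 1 else 0))"

text \<open>\<open>expect \<rho> f g\<close> is the expectation value $\omega(a^*(f)a(g)) = \mathrm{Tr}\,\rho\,a^*(f)a(g)
  = \sum_j w_j \langle\Psi_j, a^*(f)a(g)\Psi_j\rangle$. As usual for unbounded operators, the
  diagonal elements are taken in the sense of forms, i.e. as
  $\langle a(f)\Psi_j, a(g)\Psi_j\rangle$: an eigenvector in the domains of $a(f)$ and $a(g)$ need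
  not lie in the domain of the product.\<close>

definition expect :: "('n::finite) density \<Rightarrow> 'n wave \<Rightarrow> 'n wave \<Rightarrow> complex" where
  "expect \<rho> f g = (\<Sum>j. complex_of_real (weight \<rho> j) *
     fock_inner (annihilate f (eigvec \<rho> j)) (annihilate g (eigvec \<rho> j)))"

text \<open>The second conjunct expresses $\omega(a^*(f)a(f)) < \infty$ for all $f$.\<close>

definition fock_state :: "('n::finite) density \<Rightarrow> bool" where
  "fock_state \<rho> \<longleftrightarrow> density_matrix \<rho> \<and>
     (\<forall>f \<in> L2 lborel.
        (\<forall>j. weight \<rho> j > 0 \<longrightarrow> annihilate f (eigvec \<rho> j) \<in> fock_space) \<and>
        summable (\<lambda>j. weight \<rho> j *
          Re (fock_inner (annihilate f (eigvec \<rho> j)) (annihilate f (eigvec \<rho> j)))))"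

definition occupation :: "('n::finite) density \<Rightarrow> 'n wave \<Rightarrow> real" where
  "occupation \<rho> f = Re (expect \<rho> f f)"


section \<open>Condensates\<close>

text \<open>A sequence of states is a function \<open>\<omega>\<close> on the reals of which only the values at \<open>\<sigma> > 0\<close>
  matter.\<close>

definition regular_subspace ::
    "(real \<Rightarrow> 'n density) \<Rightarrow> (real ^ 'n::finite) set \<Rightarrow> 'n wave set" where
  "regular_subspace \<omega> U =
     {f \<in> L2_on U. Limsup at_top (\<lambda>\<sigma>. ereal (occupation (\<omega> \<sigma>) f)) < \<infinity>}"

definition l2_closed_in :: "('n::finite) wave set \<Rightarrow> 'n wave set \<Rightarrow> bool" where
  "l2_closed_in R H \<longleftrightarrow>
     (\<forall>F f. (\<forall>k. F k \<in> R) \<and> f \<in> H \<and>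
        (\<lambda>k::nat. l2_norm lborel (\<lambda>x. F k x - f x)) \<longlonglongrightarrow> 0 \<longrightarrow> f \<in> R)"

definition orth_complement :: "('n::finite) wave set \<Rightarrow> 'n wave set \<Rightarrow> 'n wave set" where
  "orth_complement H R = {g \<in> H. \<forall>f \<in> R. l2_inner lborel f g = 0}"

definition proper_condensate ::
    "(real \<Rightarrow> 'n density) \<Rightarrow> (real ^ 'n::finite) set \<Rightarrow> 'n wave \<Rightarrow> bool" where
  "proper_condensate \<omega> U s \<longleftrightarrow>
     l2_closed_in (regular_subspace \<omega> U) (L2_on U) \<and>
     s \<in> L2_on U - regular_subspace \<omega> U \<and> l2_norm lborel s = 1 \<and>
     orth_complement (L2_on U) (regular_subspace \<omega> U) =
       {g \<in> L2 lborel. \<exists>c. AE x in lborel. g x = c * s x}"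

definition condensate_number :: "(real \<Rightarrow> 'n density) \<Rightarrow> ('n::finite) wave \<Rightarrow> real \<Rightarrow> real" where
  "condensate_number \<omega> s \<sigma> = occupation (\<omega> \<sigma>) s"

text \<open>The limit is taken along all sequences \<open>\<tau>\<close> of parameters tending to infinity along which
  the condensate particle number diverges.\<close>

definition homogeneous_proper_condensate ::
    "(real \<Rightarrow> 'n density) \<Rightarrow> (real ^ 'n::finite) set \<Rightarrow> 'n wave \<Rightarrow> bool" where
  "homogeneous_proper_condensate \<omega> U s \<longleftrightarrow>
     proper_condensate \<omega> U s \<and>
     (\<forall>V x f g \<tau>.
        V \<Subset> U \<and> (\<lambda>z. z - x) ` V \<Subset> U \<and> f \<in> L2_on V \<and> g \<in> L2_on V \<and>
        filterlim \<tau> at_top sequentially \<and>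
        filterlim (\<lambda>k. condensate_number \<omega> s (\<tau> k)) at_top sequentially \<longrightarrow>
        (\<lambda>k. expect (\<omega> (\<tau> k)) (translate x f) (translate x g) /
              complex_of_real (condensate_number \<omega> s (\<tau> k)))
          \<longlonglongrightarrow> l2_inner lborel s f * l2_inner lborel g s)"

definition plane_wave :: "(real ^ 'n::finite) set \<Rightarrow> real ^ 'n \<Rightarrow> 'n wave" where
  "plane_wave U k x =
     (if x \<in> U then complex_of_real (1 / sqrt (measure lborel U)) * cis (x \<bullet> k) else 0)"

definition condensate_momentum ::
    "(real ^ 'n::finite) set \<Rightarrow> 'n wave \<Rightarrow> real ^ 'n \<Rightarrow> bool" where
  "condensate_momentum U s p \<longleftrightarrow>
     (\<exists>c. cmod c = 1 \<and> (AE x in lborel. s x = c * plane_wave U p x))"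

definition regular_occupation_bound ::
    "(real \<Rightarrow> 'n density) \<Rightarrow> (real ^ 'n::finite) set \<Rightarrow> real \<Rightarrow> bool" where
  "regular_occupation_bound \<omega> U nR \<longleftrightarrow>
     (\<forall>\<sigma>>0. \<forall>f \<in> regular_subspace \<omega> U. occupation (\<omega> \<sigma>) f \<le> nR * (l2_norm lborel f)\<^sup>2)"

text \<open>The squared overlap of two plane waves on \<open>U\<close> with momenta differing by \<open>q\<close>.\<close>

definition form_factor :: "(real ^ 'n::finite) set \<Rightarrow> real ^ 'n \<Rightarrow> real" where
  "form_factor U q = (cmod ((LINT x:U|lborel. cis (x \<bullet> q)) / complex_of_real (measure lborel U)))\<^sup>2"

text \<open>The closed formula $d^2 u^{-2d} (\int_0^u r^{d-2} \sin r\,dr)^2$, $u = L|q|/2$, with its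
  limiting value 1 at \<open>u = 0\<close>. It is obtained from \<^const>\<open>form_factor\<close> of a ball of diameter L by
  writing the mean of a plane wave over a sphere of radius r as $\sin(r)/r$. That mean value
  formula holds in dimension 3 only, and for $d \neq 3$ the two functions differ: for \<open>d = 1\<close> the
  form factor is $(\sin u/u)^2$, whereas the closed formula is $(u^{-1}\int_0^u \sin(r)/r\,dr)^2$.\<close>

definition peak_profile :: "nat \<Rightarrow> real \<Rightarrow> real" where
  "peak_profile d u =
     (if u = 0 then 1
      else (real d)\<^sup>2 * u powi (- 2 * int d) *
           (integral {0..u} (\<lambda>r. r powi (int d - 2) * sin r))\<^sup>2)"

end

theory Submission
  imports Defs
begin

text \<open>The form \<open>(f, g) \<mapsto> \<omega>(a\<^sup>*(f) a(g))\<close> is sesquilinear and positive, hence obeys the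
  Cauchy-Schwarz inequality. A function \<open>f\<close> supported in the large ball splits into its component
  along \<open>s\<close> and a remainder orthogonal to \<open>s\<close>, which is regular because the regular subspace is
  closed. Inserting the splitting, the product of the \<open>s\<close>-components is the main term, with the
  overlap of \<open>s\<close> and \<open>f\<close> given by the Fourier transform of \<open>f\<close> at the condensate momentum; the two
  mixed terms and the regular term are each bounded by the asserted error, so that \<open>C = 3\<close> works.
  In dimension 3 the form factor of a ball is computed by slicing perpendicular to the momentum,
  which leaves the Fourier integral of a parabola.\<close>

text \<open>The thresholds on \<open>\<sigma>\<close> come from the regular-regular term.
  Cauchy-Schwarz bounds it by the regular occupation bound n_R and nothing better, and n_R is at
  most b sqrt(n_R n_C) as soon as n_R <= b^2 n_C, where b bounds the overlaps with \<open>s\<close>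
  of the functions inserted. In the first part b^2 is the ratio of the two volumes, since
  \<open>s\<close> has constant modulus on the large ball and only that fraction of its squared norm
  lives on a translate of the small one; in the second part b = 1. One estimate with b as a
  parameter thus serves both parts. The costly step is that orthogonality to \<open>s\<close>
  implies regularity. A proper condensate prescribes the orthogonal complement of the regular
  subspace, so the step asks for the complement of a complement; getting back needs the projection
  theorem, hence completeness of L2. As vectors are functions and not classes, identities hold up to
  null sets, and closedness of the regular subspace also serves to replace a function by an almost
  everywhere equal one.\<close>

text \<open>The polynomial in \<open>t\<close> is a positive form evaluated at one vector plus
  \<open>t\<close> times another, with diagonal values \<open>A\<close>, \<open>D\<close> and mixed
  value \<open>B\<close>. In terms of numbers it applies alike to the inner product of L2, to the
  expectation of a state and to the minimality of a projection.\<close>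

lemma hermitian_form_Cauchy_Schwarz:
  fixes B :: complex and A D :: real
  assumes "\<And>t. 0 \<le> A + 2 * Re (t * B) + (cmod t)\<^sup>2 * D" and "0 \<le> A" and "0 \<le> D"
  shows "(cmod B)\<^sup>2 \<le> A * D"
proof (cases "D = 0")
  case False
  \<comment> \<open>This \<open>t\<close> minimises the polynomial.\<close>
  have "0 \<le> A + 2 * Re ((- cnj B / D) * B) + (cmod (- cnj B / D))\<^sup>2 * D"
    by (rule assms(1))
  also have "\<dots> = A - (cmod B)\<^sup>2 / D"
    using False unfolding cmod_power2 by (simp add: field_simps power2_eq_square)
  finally show ?thesis
    using False assms(3) by (simp add: field_simps)
next
  case True
  have "B = 0"
  proof (rule ccontr)
    assume "B \<noteq> 0"
    \<comment> \<open>For \<open>D = 0\<close> the polynomial is affine in \<open>t\<close>; along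
      the direction \<open>cnj B\<close> this factor brings it down to \<open>- A - 2\<close>, which
      is negative.\<close>
    define t where "t = - (A + 1) / (cmod B)\<^sup>2"
    have "0 \<le> A + 2 * Re ((t * cnj B) * B)"
      using assms(1)[of "t * cnj B"] True by simp
    also have "Re ((t * cnj B) * B) = t * (cmod B)\<^sup>2"
      unfolding cmod_power2 by (simp add: power2_eq_square algebra_simps)
    also have "\<dots> = - (A + 1)"
      using \<open>B \<noteq> 0\<close> by (simp add: t_def)
    finally show False
      using \<open>0 \<le> A\<close> by simp
  qed
  then show ?thesis
    using True by simp
qed

section \<open>Geometry of L2\<close>

lemma measurable_cnj [measurable]: "cnj \<in> borel_measurable borel"
  by (intro borel_measurable_continuous_onI continuous_intros)

lemma L2_measurable: "f \<in> L2 M \<Longrightarrow> f \<in> borel_measurable M"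
  by (simp add: L2_def)

lemma L2_square_integrable: "f \<in> L2 M \<Longrightarrow> integrable M (\<lambda>x. (cmod (f x))\<^sup>2)"
  by (simp add: L2_def)

lemma cmod_add_scale_square_le:
  "(cmod (a + c * b))\<^sup>2 \<le> 2 * (cmod a)\<^sup>2 + 2 * (cmod c)\<^sup>2 * (cmod b)\<^sup>2"
proof -
  have "(cmod (a + c * b))\<^sup>2 \<le> (cmod a + cmod c * cmod b)\<^sup>2"
    by (metis norm_triangle_ineq norm_mult norm_ge_zero power_mono)
  also have "\<dots> \<le> 2 * (cmod a)\<^sup>2 + 2 * (cmod c)\<^sup>2 * (cmod b)\<^sup>2"
    using sum_squares_bound[of "cmod a" "cmod c * cmod b"]
    by (simp add: power2_sum power_mult_distrib mult.commute)
  finally show ?thesis .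
qed

lemma L2_add_scale:
  assumes "f \<in> L2 M" and "g \<in> L2 M"
  shows "(\<lambda>x. f x + c * g x) \<in> L2 M"
proof -
  note [measurable] = assms[THEN L2_measurable]
  have "integrable M (\<lambda>x. 2 * (cmod (f x))\<^sup>2 + 2 * (cmod c)\<^sup>2 * (cmod (g x))\<^sup>2)"
    using assms[THEN L2_square_integrable] by auto
  then have "integrable M (\<lambda>x. (cmod (f x + c * g x))\<^sup>2)"
    by (rule Bochner_Integration.integrable_bound)
       (use cmod_add_scale_square_le in \<open>auto intro!: AE_I2\<close>)
  then show ?thesis
    by (simp add: L2_def)
qed

lemma L2_diff: "f \<in> L2 M \<Longrightarrow> g \<in> L2 M \<Longrightarrow> (\<lambda>x. f x - g x) \<in> L2 M"
  using L2_add_scale[of f M g "-1"] by simp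

lemma L2_zero: "(\<lambda>x. 0) \<in> L2 M"
  by (simp add: L2_def)

lemma L2_scale: "f \<in> L2 M \<Longrightarrow> (\<lambda>x. c * f x) \<in> L2 M"
  using L2_add_scale[OF L2_zero, of f M c] by simp

lemma cmod_mult_le_half_squares: "cmod (cnj a * b) \<le> ((cmod a)\<^sup>2 + (cmod b)\<^sup>2) / 2"
  using sum_squares_bound[of "cmod a" "cmod b"] by (simp add: norm_mult)

lemma L2_mult_integrable:
  assumes "f \<in> L2 M" and "g \<in> L2 M"
  shows "integrable M (\<lambda>x. cnj (f x) * g x)"
proof -
  note [measurable] = assms[THEN L2_measurable]
  have "integrable M (\<lambda>x. ((cmod (f x))\<^sup>2 + (cmod (g x))\<^sup>2) / 2)"
    using assms[THEN L2_square_integrable] by auto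
  then show ?thesis
    by (rule Bochner_Integration.integrable_bound)
       (use cmod_mult_le_half_squares in \<open>auto intro!: AE_I2 simp del: complex_mod_cnj norm_mult\<close>)
qed

lemma l2_inner_cnj: "l2_inner M g f = cnj (l2_inner M f g)"
  unfolding l2_inner_def by (subst Bochner_Integration.integral_cnj[symmetric]) (simp add: mult.commute)

lemma l2_norm_square: "(l2_norm M f)\<^sup>2 = (LINT x|M. (cmod (f x))\<^sup>2)"
  by (simp add: l2_norm_def)

lemma l2_norm_nonneg [simp]: "0 \<le> l2_norm M f"
  by (simp add: l2_norm_def)

lemma l2_inner_self: "l2_inner M f f = complex_of_real ((l2_norm M f)\<^sup>2)"
proof -
  have "l2_inner M f f = (LINT x|M. complex_of_real ((cmod (f x))\<^sup>2))"
    unfolding l2_inner_def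
    by (intro Bochner_Integration.integral_cong refl) (simp only: complex_norm_square mult.commute)
  then show ?thesis
    by (simp only: l2_norm_square integral_complex_of_real)
qed

lemma l2_inner_add_scale_right:
  assumes "f \<in> L2 M" "g \<in> L2 M" "h \<in> L2 M"
  shows "l2_inner M f (\<lambda>x. g x + c * h x) = l2_inner M f g + c * l2_inner M f h"
proof -
  have "l2_inner M f (\<lambda>x. g x + c * h x) = (LINT x|M. cnj (f x) * g x + c * (cnj (f x) * h x))"
    unfolding l2_inner_def by (intro Bochner_Integration.integral_cong) (auto simp: algebra_simps)
  also have "\<dots> = l2_inner M f g + c * l2_inner M f h"
    using L2_mult_integrable[OF assms(1,2)] L2_mult_integrable[OF assms(1,3)]
    unfolding l2_inner_def by simp
  finally show ?thesis .
qed

lemma l2_inner_diff_right: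
  assumes "f \<in> L2 M" "g \<in> L2 M" "h \<in> L2 M"
  shows "l2_inner M f (\<lambda>x. g x - h x) = l2_inner M f g - l2_inner M f h"
  using l2_inner_add_scale_right[OF assms, of "-1"] by simp

lemma l2_inner_add_scale_left:
  assumes "f \<in> L2 M" "g \<in> L2 M" "h \<in> L2 M"
  shows "l2_inner M (\<lambda>x. g x + c * h x) f = l2_inner M g f + cnj c * l2_inner M h f"
  using l2_inner_add_scale_right[OF assms, of c]
  by (subst (1 2 3) l2_inner_cnj) simp

lemma l2_norm_add_scale_square:
  assumes "f \<in> L2 M" "g \<in> L2 M"
  shows "(l2_norm M (\<lambda>x. f x + c * g x))\<^sup>2
       = (l2_norm M f)\<^sup>2 + 2 * Re (c * l2_inner M f g) + (cmod c)\<^sup>2 * (l2_norm M g)\<^sup>2"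
proof -
  have "complex_of_real ((l2_norm M (\<lambda>x. f x + c * g x))\<^sup>2)
      = l2_inner M f f + c * l2_inner M f g + cnj c * (l2_inner M g f + c * l2_inner M g g)"
    using assms
    unfolding l2_inner_self[symmetric]
    by (simp add: l2_inner_add_scale_left l2_inner_add_scale_right L2_add_scale)
  also have "\<dots> = complex_of_real ((l2_norm M f)\<^sup>2 + 2 * Re (c * l2_inner M f g)
      + (cmod c)\<^sup>2 * (l2_norm M g)\<^sup>2)"
    unfolding l2_inner_cnj[of M g f] l2_inner_self
    by (simp add: complex_eq_iff cmod_power2) (simp add: algebra_simps power2_eq_square)
  finally show ?thesis
    by (simp only: of_real_eq_iff)
qed

lemma l2_Cauchy_Schwarz:
  assumes "f \<in> L2 M" "g \<in> L2 M"
  shows "cmod (l2_inner M f g) \<le> l2_norm M f * l2_norm M g"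
proof -
  have "(cmod (l2_inner M f g))\<^sup>2 \<le> (l2_norm M f)\<^sup>2 * (l2_norm M g)\<^sup>2"
    by (rule hermitian_form_Cauchy_Schwarz)
       (simp_all only: l2_norm_add_scale_square[OF assms, symmetric] zero_le_power2)
  then show ?thesis
    by (metis l2_norm_nonneg mult_nonneg_nonneg power2_le_imp_le power_mult_distrib)
qed

lemma l2_norm_triangle:
  assumes "f \<in> L2 M" "g \<in> L2 M"
  shows "l2_norm M (\<lambda>x. f x + g x) \<le> l2_norm M f + l2_norm M g"
proof (rule power2_le_imp_le)
  have "Re (l2_inner M f g) \<le> l2_norm M f * l2_norm M g"
    using l2_Cauchy_Schwarz[OF assms] complex_Re_le_cmod order_trans by blast
  then show "(l2_norm M (\<lambda>x. f x + g x))\<^sup>2 \<le> (l2_norm M f + l2_norm M g)\<^sup>2"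
    using l2_norm_add_scale_square[OF assms, of 1] by (simp add: power2_sum)
qed simp

lemma l2_norm_minus_commute: "l2_norm M (\<lambda>x. f x - g x) = l2_norm M (\<lambda>x. g x - f x)"
  by (simp add: l2_norm_def norm_minus_commute)

lemma l2_dist_triangle:
  assumes "f \<in> L2 M" "g \<in> L2 M" "h \<in> L2 M"
  shows "l2_norm M (\<lambda>x. f x - h x) \<le> l2_norm M (\<lambda>x. f x - g x) + l2_norm M (\<lambda>x. g x - h x)"
  using l2_norm_triangle[OF L2_diff[OF assms(1,2)] L2_diff[OF assms(2,3)]] by simp

section \<open>Completeness of L2 and orthogonal projection\<close>

lemma nn_integral_cmod_square:
  "f \<in> L2 M \<Longrightarrow> (\<integral>\<^sup>+ x. ennreal ((cmod (f x))\<^sup>2) \<partial>M) = ennreal ((l2_norm M f)\<^sup>2)"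
  unfolding l2_norm_square by (intro nn_integral_eq_integral L2_square_integrable AE_I2) auto

text \<open>The bound is the exact partial sum of the geometric series; the simpler bound
  \<open>2 * (1/2) ^ k\<close> would not survive the induction on \<open>j\<close>.\<close>

lemma l2_dist_geometric:
  assumes F: "\<And>k. F k \<in> L2 M"
    and step: "\<And>k. l2_norm M (\<lambda>x. F (Suc k) x - F k x) \<le> (1/2) ^ k"
  shows "l2_norm M (\<lambda>x. F (k + j) x - F k x) \<le> 2 * (1/2) ^ k * (1 - (1/2) ^ j)"
proof (induction j)
  case 0
  then show ?case by (simp add: l2_norm_def)
next
  case (Suc j)
  have "l2_norm M (\<lambda>x. F (k + Suc j) x - F k x)
      \<le> l2_norm M (\<lambda>x. F (Suc (k + j)) x - F (k + j) x) + l2_norm M (\<lambda>x. F (k + j) x - F k x)"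
    using l2_dist_triangle[OF F[of "Suc (k + j)"] F[of "k + j"] F[of k]] by simp
  also have "\<dots> \<le> (1/2) ^ (k + j) + 2 * (1/2) ^ k * (1 - (1/2) ^ j)"
    by (intro add_mono step Suc)
  also have "\<dots> = 2 * (1/2) ^ k * (1 - (1/2) ^ Suc j)"
    by (simp add: power_add algebra_simps)
  finally show ?case .
qed

text \<open>The squared increments have integrals at most 4^-k, so the weights 2^k still leave a
  summable series. Where the weighted sum \<open>H\<close> is finite, the increments decay like
  2^(-k/2) and are absolutely summable. Working with squares avoids integrating the increments
  themselves, which need not be integrable on a space of infinite measure.\<close>

lemma AE_convergent_geometric:
  fixes F :: "nat \<Rightarrow> 'a \<Rightarrow> complex"
  assumes F: "\<And>k. F k \<in> L2 M"
    and step: "\<And>k. l2_norm M (\<lambda>x. F (Suc k) x - F k x) \<le> (1/2) ^ k"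
  shows "AE x in M. convergent (\<lambda>k. F k x)"
proof -
  note [measurable] = F[THEN L2_measurable]
  define H where "H x = (\<Sum>k. ennreal (2 ^ k * (cmod (F (Suc k) x - F k x))\<^sup>2))" for x
  have [measurable]: "H \<in> borel_measurable M"
    unfolding H_def by measurable
  have "(\<integral>\<^sup>+ x. H x \<partial>M) = (\<Sum>k. \<integral>\<^sup>+ x. ennreal (2 ^ k * (cmod (F (Suc k) x - F k x))\<^sup>2) \<partial>M)"
    unfolding H_def by (rule nn_integral_suminf) measurable
  also have "\<dots> \<le> (\<Sum>k. ennreal ((1/2) ^ k))"
  proof (intro suminf_le)
    fix k
    have "(\<integral>\<^sup>+ x. ennreal (2 ^ k * (cmod (F (Suc k) x - F k x))\<^sup>2) \<partial>M)
        = ennreal (2 ^ k) * ennreal ((l2_norm M (\<lambda>x. F (Suc k) x - F k x))\<^sup>2)"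
      by (simp add: ennreal_mult nn_integral_cmult nn_integral_cmod_square[OF L2_diff[OF F F]])
    also have "\<dots> \<le> ennreal (2 ^ k) * ennreal (((1/2) ^ k)\<^sup>2)"
      by (intro mult_left_mono ennreal_leI power_mono step) auto
    also have "\<dots> = ennreal ((1/2) ^ k)"
      by (simp add: ennreal_mult[symmetric] power2_eq_square field_simps)
    finally show "(\<integral>\<^sup>+ x. ennreal (2 ^ k * (cmod (F (Suc k) x - F k x))\<^sup>2) \<partial>M) \<le> ennreal ((1/2) ^ k)" .
  qed auto
  also have "\<dots> = ennreal (\<Sum>k. (1/2) ^ k)"
    by (rule suminf_ennreal2) auto
  also have "\<dots> < \<infinity>" by simp
  finally have "AE x in M. H x \<noteq> \<infinity>"
    by (intro nn_integral_PInf_AE) auto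
  then show ?thesis
  proof eventually_elim
    case (elim x)
    obtain B where B: "0 \<le> B" "H x = ennreal B"
      using elim by (cases "H x") auto
    have sq: "((sqrt (1/2)) ^ k)\<^sup>2 = 1 / 2 ^ k" for k :: nat
      unfolding power2_eq_square power_mult_distrib[symmetric] real_sqrt_mult_self
      by (simp add: power_one_over)
    have bound: "norm (F (Suc k) x - F k x) \<le> sqrt B * (sqrt (1/2)) ^ k" for k
    proof (rule power2_le_imp_le)
      have "ennreal (2 ^ k * (cmod (F (Suc k) x - F k x))\<^sup>2) \<le> H x"
        unfolding H_def by (rule sum_le_suminf[OF summableI, of "{k}", simplified])
      then have "2 ^ k * (cmod (F (Suc k) x - F k x))\<^sup>2 \<le> B"
        using B by simp
      then show "(norm (F (Suc k) x - F k x))\<^sup>2 \<le> (sqrt B * (sqrt (1/2)) ^ k)\<^sup>2"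
        unfolding power_mult_distrib sq using B by (simp add: field_simps)
    qed (use B in auto)
    have "summable (\<lambda>k. sqrt B * (sqrt (1/2)) ^ k)"
      by (intro summable_mult summable_geometric) (simp add: real_sqrt_lt_1_iff)
    then have "summable (\<lambda>k. F (Suc k) x - F k x)"
      by (rule summable_comparison_test') (rule bound)
    then show "convergent (\<lambda>k. F k x)"
      by (simp only: summable_iff_convergent sum_lessThan_telescope[of "\<lambda>k. F k x"]
          convergent_diff_const_right_iff)
  qed
qed

text \<open>Fatou's lemma carries the bound on the distance between \<open>F (k + j)\<close> and
  \<open>F k\<close>, which is uniform in \<open>j\<close>, over to the pointwise limit. This yields
  membership in L2 and the rate of convergence at once.\<close>

lemma L2_complete_geometric:
  fixes F :: "nat \<Rightarrow> 'a \<Rightarrow> complex"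
  assumes F: "\<And>k. F k \<in> L2 M"
    and step: "\<And>k. l2_norm M (\<lambda>x. F (Suc k) x - F k x) \<le> (1/2) ^ k"
  obtains f where "f \<in> L2 M" "(\<lambda>k. l2_norm M (\<lambda>x. F k x - f x)) \<longlonglongrightarrow> 0"
proof -
  note [measurable] = F[THEN L2_measurable]
  \<comment> \<open>Where the sequence diverges, \<open>lim\<close> has an unspecified value; this
    concerns a null set only, and \<open>f\<close> is measurable all the same.\<close>
  define f where "f x = lim (\<lambda>k. F k x)" for x
  have [measurable]: "f \<in> borel_measurable M"
    unfolding f_def by measurable
  have fatou: "(\<integral>\<^sup>+ x. ennreal ((cmod (f x - F k x))\<^sup>2) \<partial>M) \<le> ennreal ((2 * (1/2) ^ k)\<^sup>2)" for k
  proof -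
    have "(\<integral>\<^sup>+ x. ennreal ((cmod (f x - F k x))\<^sup>2) \<partial>M)
        = (\<integral>\<^sup>+ x. liminf (\<lambda>j. ennreal ((cmod (F (k + j) x - F k x))\<^sup>2)) \<partial>M)"
    proof (rule nn_integral_cong_AE)
      show "AE x in M. ennreal ((cmod (f x - F k x))\<^sup>2)
          = liminf (\<lambda>j. ennreal ((cmod (F (k + j) x - F k x))\<^sup>2))"
        using AE_convergent_geometric[OF F step]
      proof eventually_elim
        case (elim x)
        then have "(\<lambda>j. F j x) \<longlonglongrightarrow> f x"
          unfolding f_def by (simp add: convergent_LIMSEQ_iff)
        from LIMSEQ_ignore_initial_segment[OF this, of k]
        have "(\<lambda>j. ennreal ((cmod (F (k + j) x - F k x))\<^sup>2)) \<longlonglongrightarrow> ennreal ((cmod (f x - F k x))\<^sup>2)"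
          by (intro tendsto_intros) (simp add: add.commute)
        from lim_imp_Liminf[OF _ this] show ?case by simp
      qed
    qed
    also have "\<dots> \<le> liminf (\<lambda>j. \<integral>\<^sup>+ x. ennreal ((cmod (F (k + j) x - F k x))\<^sup>2) \<partial>M)"
      by (rule nn_integral_liminf) measurable
    also have "\<dots> \<le> liminf (\<lambda>j. ennreal ((2 * (1/2) ^ k)\<^sup>2))"
    proof (intro Liminf_mono always_eventually allI)
      fix j
      have "l2_norm M (\<lambda>x. F (k + j) x - F k x) \<le> 2 * (1/2) ^ k * (1 - (1/2) ^ j)"
        by (rule l2_dist_geometric[OF F step])
      also have "\<dots> \<le> 2 * (1/2) ^ k"
        by (simp add: mult_le_cancel_left1)
      finally show "(\<integral>\<^sup>+ x. ennreal ((cmod (F (k + j) x - F k x))\<^sup>2) \<partial>M) \<le> ennreal ((2 * (1/2) ^ k)\<^sup>2)"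
        unfolding nn_integral_cmod_square[OF L2_diff[OF F F]]
        by (intro ennreal_leI power_mono) auto
    qed
    also have "\<dots> = ennreal ((2 * (1/2) ^ k)\<^sup>2)"
      by (simp add: Liminf_const)
    finally show ?thesis .
  qed
  have diff: "(\<lambda>x. f x - F k x) \<in> L2 M" for k
    unfolding L2_def
    by (auto intro!: integrableI_bounded le_less_trans[OF fatou[of k]])
  have "f \<in> L2 M"
    using L2_add_scale[OF diff[of 0] F[of 0], of 1] by simp
  moreover have "(\<lambda>k. l2_norm M (\<lambda>x. F k x - f x)) \<longlonglongrightarrow> 0"
  proof (rule tendsto_sandwich[where f = "\<lambda>_. 0"])
    show "\<forall>\<^sub>F k in sequentially. l2_norm M (\<lambda>x. F k x - f x) \<le> 2 * (1/2) ^ k"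
    proof (intro always_eventually allI)
      fix k
      have "(l2_norm M (\<lambda>x. f x - F k x))\<^sup>2 \<le> (2 * (1/2) ^ k)\<^sup>2"
        using fatou[of k] unfolding nn_integral_cmod_square[OF diff]
        by (subst (asm) ennreal_le_iff) auto
      then show "l2_norm M (\<lambda>x. F k x - f x) \<le> 2 * (1/2) ^ k"
        by (subst l2_norm_minus_commute) (rule power2_le_imp_le, auto)
    qed
    show "(\<lambda>k. 2 * (1/2) ^ k :: real) \<longlonglongrightarrow> 0"
      using tendsto_mult_right_zero[OF LIMSEQ_power_zero[of "1/2 :: real"], of 2] by simp
  qed auto
  ultimately show ?thesis by (rule that)
qed

text \<open>A sequence minimising the distance to \<open>h\<close> is Cauchy by the parallelogram
  law, its limit lies in \<open>R\<close> by closedness, and minimality at the limit forces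
  orthogonality.\<close>

lemma l2_projection:
  assumes R: "R \<subseteq> L2 M" and zero: "(\<lambda>x. 0) \<in> R"
    and lin: "\<And>f g c. f \<in> R \<Longrightarrow> g \<in> R \<Longrightarrow> (\<lambda>x. f x + c * g x) \<in> R"
    and closed: "\<And>F f. (\<And>k. F k \<in> R) \<Longrightarrow> f \<in> L2 M \<Longrightarrow>
        (\<lambda>k::nat. l2_norm M (\<lambda>x. F k x - f x)) \<longlonglongrightarrow> 0 \<Longrightarrow> f \<in> R"
    and h: "h \<in> L2 M"
  obtains r where "r \<in> R" "\<And>g. g \<in> R \<Longrightarrow> l2_inner M g (\<lambda>x. h x - r x) = 0"
proof -
  define N where "N r = (l2_norm M (\<lambda>x. h x - r x))\<^sup>2" for r
  define d where "d = Inf (N ` R)"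
  have bdd: "bdd_below (N ` R)"
    by (rule bdd_belowI[of _ 0]) (auto simp: N_def)
  have d_le: "d \<le> N r" if "r \<in> R" for r
    unfolding d_def using that bdd by (intro cInf_lower) auto
  \<comment> \<open>The tolerance is fixed in advance so that the increments of the minimising
    sequence come out at most (1/2)^k: the parallelogram law gives 2/16 + 2/4 times 4^-k for their
    squares.\<close>
  have "\<exists>r\<in>R. N r < d + (1/4) ^ Suc k" for k :: nat
    using cInf_lessD[of "N ` R" "d + (1/4) ^ Suc k"] zero unfolding d_def by auto
  then obtain F where F: "\<And>k. F k \<in> R" and NF: "\<And>k. N (F k) < d + (1/4) ^ Suc k"
    by metis
  have FL: "F k \<in> L2 M" for k using F R by auto
  \<comment> \<open>The parallelogram law for \<open>h - f\<close> and \<open>h - g\<close>; half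
    their sum is the distance vector to the midpoint of \<open>f\<close> and \<open>g\<close>, which
    lies in \<open>R\<close> and hence has squared norm at least \<open>d\<close>.\<close>
  have par: "(l2_norm M (\<lambda>x. f x - g x))\<^sup>2 \<le> 2 * N f + 2 * N g - 4 * d"
    if "f \<in> R" "g \<in> R" for f g
  proof -
    have L: "f \<in> L2 M" "g \<in> L2 M" using that R by auto
    define u v where "u = (\<lambda>x. h x - f x)" and "v = (\<lambda>x. h x - g x)"
    have uv: "u \<in> L2 M" "v \<in> L2 M" unfolding u_def v_def by (intro L2_diff h L)+
    have "d \<le> N (\<lambda>x. (1/2) * f x + (1/2) * g x)"
      using lin[OF lin[OF zero that(1), of "1/2"] that(2), of "1/2"] by (intro d_le) simp
    also have "\<dots> = (l2_norm M (\<lambda>x. (1/2) * (u x + 1 * v x)))\<^sup>2"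
      unfolding N_def u_def v_def by (intro arg_cong[where f = "\<lambda>f. (l2_norm M f)\<^sup>2"]) (auto simp: fun_eq_iff field_simps)
    also have "\<dots> = (1/4) * (l2_norm M (\<lambda>x. u x + 1 * v x))\<^sup>2"
      unfolding l2_norm_square by (simp add: norm_mult norm_divide power_mult_distrib power_divide)
    finally have *: "4 * d \<le> (l2_norm M (\<lambda>x. u x + 1 * v x))\<^sup>2" by simp
    have "(\<lambda>x. f x - g x) = (\<lambda>x. v x + (-1) * u x)"
      by (auto simp: u_def v_def)
    then show ?thesis
      using * l2_norm_add_scale_square[OF uv, of 1] l2_norm_add_scale_square[OF uv(2,1), of "-1"]
        l2_inner_cnj[of M v u]
      by (simp add: N_def u_def[symmetric] v_def[symmetric])
  qed
  have step: "l2_norm M (\<lambda>x. F (Suc k) x - F k x) \<le> (1/2) ^ k" for k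
  proof (rule power2_le_imp_le)
    have "(l2_norm M (\<lambda>x. F (Suc k) x - F k x))\<^sup>2 \<le> 2 * (1/4) ^ Suc (Suc k) + 2 * (1/4) ^ Suc k"
      using par[OF F F, of "Suc k" k] NF[of k] NF[of "Suc k"] by linarith
    also have "\<dots> \<le> (1/4) ^ k" by simp
    also have "\<dots> = ((1/2) ^ k)\<^sup>2"
      by (simp add: power2_eq_square flip: power_mult_distrib)
    finally show "(l2_norm M (\<lambda>x. F (Suc k) x - F k x))\<^sup>2 \<le> ((1/2) ^ k)\<^sup>2" .
  qed simp
  obtain r where r: "r \<in> L2 M" and lim: "(\<lambda>k. l2_norm M (\<lambda>x. F k x - r x)) \<longlonglongrightarrow> 0"
    using L2_complete_geometric[OF FL step] by blast
  have rR: "r \<in> R" by (rule closed[OF F r lim])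
  have "N r \<le> d"
  proof -
    have "sqrt (N r) \<le> sqrt d"
    proof (rule LIMSEQ_le)
      show "(\<lambda>k. sqrt (N (F k)) + l2_norm M (\<lambda>x. F k x - r x)) \<longlonglongrightarrow> sqrt d"
      proof -
        have "(\<lambda>k. N (F k)) \<longlonglongrightarrow> d"
        proof (rule tendsto_sandwich[where f = "\<lambda>_. d"])
          show "(\<lambda>k. d + (1/4) ^ Suc k) \<longlonglongrightarrow> d"
            using tendsto_add[OF tendsto_const LIMSEQ_Suc[OF LIMSEQ_power_zero[of "1/4 :: real"]], of d]
            by simp
        qed (use d_le F NF in \<open>auto intro!: always_eventually less_imp_le simp del: power_Suc\<close>)
        from tendsto_add[OF tendsto_real_sqrt[OF this] lim] show ?thesis by simp
      qed
      show "(\<lambda>k. sqrt (N r)) \<longlonglongrightarrow> sqrt (N r)" by simp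
      show "\<exists>n. \<forall>k\<ge>n. sqrt (N r) \<le> sqrt (N (F k)) + l2_norm M (\<lambda>x. F k x - r x)"
        using l2_dist_triangle[OF h FL r] by (auto simp: N_def)
    qed
    then show ?thesis by simp
  qed
  moreover have "l2_inner M g (\<lambda>x. h x - r x) = 0" if "g \<in> R" for g
  proof -
    have g: "g \<in> L2 M" using that R by auto
    \<comment> \<open>By minimality of \<open>r\<close> the polynomial in \<open>t\<close> stays
      nonnegative even with constant term 0, and this forces its mixed value to vanish.\<close>
    have "(cmod (l2_inner M (\<lambda>x. h x - r x) g))\<^sup>2 \<le> 0 * (l2_norm M g)\<^sup>2"
    proof (rule hermitian_form_Cauchy_Schwarz)
      fix t
      have "d \<le> N (\<lambda>x. r x + (- t) * g x)"
        by (intro d_le lin rR that)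
      also have "\<dots> = (l2_norm M (\<lambda>x. (h x - r x) + t * g x))\<^sup>2"
        by (simp add: N_def algebra_simps)
      also have "\<dots> = N r + 2 * Re (t * l2_inner M (\<lambda>x. h x - r x) g) + (cmod t)\<^sup>2 * (l2_norm M g)\<^sup>2"
        unfolding N_def by (rule l2_norm_add_scale_square[OF L2_diff[OF h r] g])
      finally show "0 \<le> 0 + 2 * Re (t * l2_inner M (\<lambda>x. h x - r x) g) + (cmod t)\<^sup>2 * (l2_norm M g)\<^sup>2"
        using \<open>N r \<le> d\<close> by simp
    qed auto
    then show ?thesis
      by (subst l2_inner_cnj) simp
  qed
  ultimately show ?thesis using rR that by blast
qed

section \<open>Fock states\<close>

lemma l2_inner_cong_AE:
  assumes "f \<in> L2 M" "g \<in> L2 M" "f' \<in> L2 M" "g' \<in> L2 M"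
    and "AE x in M. f x = f' x" and "AE x in M. g x = g' x"
  shows "l2_inner M f g = l2_inner M f' g'"
  unfolding l2_inner_def
proof (rule integral_cong_AE)
  note [measurable] = assms(1-4)[THEN L2_measurable]
  show "(\<lambda>x. cnj (f x) * g x) \<in> borel_measurable M" "(\<lambda>x. cnj (f' x) * g' x) \<in> borel_measurable M"
    by measurable
  show "AE x in M. cnj (f x) * g x = cnj (f' x) * g' x"
    using assms(5,6) by eventually_elim simp
qed

text \<open>The integral in \<open>annihilate\<close> is the inner product of \<open>f\<close> with
  a section of the Fock vector in its last position. It is additive in \<open>f\<close> where that
  section is square integrable, which by Tonelli is so for almost every configuration of the other
  particles.\<close>

lemma L2_config_section:
  assumes "\<Phi> \<in> L2 (config (Suc n))"
  shows "AE x in config n. (\<lambda>y. \<Phi> (x(n := y))) \<in> L2 lborel"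
proof -
  interpret product_sigma_finite "\<lambda>_. lborel :: (real ^ 'n::finite) measure" by standard
  have ins: "{..<Suc n} = insert n {..<n}" by auto
  have [measurable]: "\<Phi> \<in> borel_measurable (Pi\<^sub>M (insert n {..<n}) (\<lambda>_. lborel))"
    using L2_measurable[OF assms] by (simp add: config_def ins)
  have [measurable]: "(\<lambda>(x, y). x(n := y)) \<in>
      measurable (Pi\<^sub>M {..<n} (\<lambda>_. lborel) \<Otimes>\<^sub>M (lborel :: (real ^ 'n) measure)) (Pi\<^sub>M (insert n {..<n}) (\<lambda>_. lborel))"
    by (rule measurable_add_dim)
  have "(\<integral>\<^sup>+ x. (\<integral>\<^sup>+ y. ennreal ((cmod (\<Phi> (x(n := y))))\<^sup>2) \<partial>lborel) \<partial>config n)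
      = (\<integral>\<^sup>+ x. ennreal ((cmod (\<Phi> x))\<^sup>2) \<partial>config (Suc n))"
    unfolding config_def ins by (rule product_nn_integral_insert[symmetric]) auto
  also have "\<dots> < \<infinity>"
    by (simp add: nn_integral_cmod_square[OF assms])
  finally have "(\<integral>\<^sup>+ x. (\<integral>\<^sup>+ y. ennreal ((cmod (\<Phi> (x(n := y))))\<^sup>2) \<partial>lborel) \<partial>config n) \<noteq> \<infinity>"
    by simp
  then have "AE x in config n. (\<integral>\<^sup>+ y. ennreal ((cmod (\<Phi> (x(n := y))))\<^sup>2) \<partial>lborel) \<noteq> \<infinity>"
    by (intro nn_integral_PInf_AE) (unfold config_def, measurable)
  then show ?thesis
    using AE_space
  proof eventually_elim
    case (elim x)
    have "(\<lambda>v. x(n := v)) \<in> measurable lborel (Pi\<^sub>M (insert n {..<n}) (\<lambda>_. lborel))"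
      using elim(2) by (intro measurable_component_update) (auto simp: config_def)
    then have [measurable]: "(\<lambda>y. \<Phi> (x(n := y))) \<in> borel_measurable lborel"
      by measurable
    show ?case
      unfolding L2_def using elim(1)
      by (auto intro!: integrableI_bounded simp: less_top)
  qed
qed

lemma annihilate_add_scale:
  assumes "f \<in> L2 lborel" "g \<in> L2 lborel" "\<Phi> (Suc n) \<in> L2 (config (Suc n))"
  shows "AE x in config n. annihilate (\<lambda>y. f y + c * g y) \<Phi> n x
      = annihilate f \<Phi> n x + cnj c * annihilate g \<Phi> n x"
  using L2_config_section[OF assms(3)]
proof eventually_elim
  case (elim x)
  have "annihilate (\<lambda>y. f y + c * g y) \<Phi> n x = complex_of_real (sqrt (real (Suc n))) *
      l2_inner lborel (\<lambda>y. f y + c * g y) (\<lambda>y. \<Phi> (Suc n) (x(n := y)))"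
    unfolding annihilate_def l2_inner_def ..
  also have "\<dots> = annihilate f \<Phi> n x + cnj c * annihilate g \<Phi> n x"
    unfolding l2_inner_add_scale_left[OF elim assms(1,2)]
    unfolding annihilate_def l2_inner_def by (simp add: algebra_simps)
  finally show ?case .
qed

lemma fock_space_L2: "\<Phi> \<in> fock_space \<Longrightarrow> \<Phi> n \<in> L2 (config n)"
  by (simp add: fock_space_def)

lemma fock_space_summable: "\<Phi> \<in> fock_space \<Longrightarrow> summable (\<lambda>n. (l2_norm (config n) (\<Phi> n))\<^sup>2)"
  by (simp add: fock_space_def)

text \<open>This weaker form of Cauchy-Schwarz is linear in the squared norms, so it can be summed
  over particle numbers and over eigenvectors and compared with series known to converge.\<close>

lemma l2_inner_le_half_squares:
  assumes "f \<in> L2 M" "g \<in> L2 M"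
  shows "cmod (l2_inner M f g) \<le> ((l2_norm M f)\<^sup>2 + (l2_norm M g)\<^sup>2) / 2"
  using l2_Cauchy_Schwarz[OF assms] sum_squares_bound[of "l2_norm M f" "l2_norm M g"] by simp

lemma fock_inner_summable:
  assumes "F \<in> fock_space" "G \<in> fock_space"
  shows "summable (\<lambda>n. cmod (l2_inner (config n) (F n) (G n)))"
proof (rule summable_comparison_test')
  show "summable (\<lambda>n. ((l2_norm (config n) (F n))\<^sup>2 + (l2_norm (config n) (G n))\<^sup>2) / 2)"
    by (intro summable_divide summable_add fock_space_summable assms)
  show "norm (cmod (l2_inner (config n) (F n) (G n)))
      \<le> ((l2_norm (config n) (F n))\<^sup>2 + (l2_norm (config n) (G n))\<^sup>2) / 2" for n
    using assms unfolding real_norm_def abs_norm_cancel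
    by (intro l2_inner_le_half_squares fock_space_L2)
qed

lemma fock_inner_self:
  assumes "F \<in> fock_space"
  shows "fock_inner F F = complex_of_real (\<Sum>n. (l2_norm (config n) (F n))\<^sup>2)"
  unfolding fock_inner_def l2_inner_self
  using fock_space_summable[OF assms] by (rule suminf_of_real[symmetric])

lemma fock_inner_self_nonneg: "F \<in> fock_space \<Longrightarrow> 0 \<le> Re (fock_inner F F)"
  by (simp add: fock_inner_self suminf_nonneg fock_space_summable)

lemma fock_inner_cnj:
  assumes "F \<in> fock_space" "G \<in> fock_space"
  shows "fock_inner G F = cnj (fock_inner F G)"
proof -
  have "(\<lambda>n. l2_inner (config n) (F n) (G n)) sums fock_inner F G"
    unfolding fock_inner_def
    using fock_inner_summable[OF assms, THEN summable_norm_cancel] by (rule summable_sums)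
  then have "(\<lambda>n. l2_inner (config n) (G n) (F n)) sums cnj (fock_inner F G)"
    by (subst l2_inner_cnj) (simp only: sums_cnj)
  then show ?thesis
    unfolding fock_inner_def[of G F] by (rule sums_unique[symmetric])
qed

text \<open>The decomposition of \<open>K\<close> is required almost everywhere in each sector,
  because \<open>annihilate\<close> is antilinear in its wave function only in that sense.\<close>

lemma fock_inner_add_scale_left:
  assumes "F \<in> fock_space" "G \<in> fock_space" "H \<in> fock_space" "K \<in> fock_space"
    and "\<And>n. AE x in config n. K n x = G n x + c * H n x"
  shows "fock_inner K F = fock_inner G F + cnj c * fock_inner H F"
proof -
  have "l2_inner (config n) (K n) (F n)
      = l2_inner (config n) (G n) (F n) + cnj c * l2_inner (config n) (H n) (F n)" for n
  proof -
    have "l2_inner (config n) (K n) (F n) = l2_inner (config n) (\<lambda>x. G n x + c * H n x) (F n)"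
      using assms by (intro l2_inner_cong_AE fock_space_L2 L2_add_scale) auto
    then show ?thesis
      using assms by (simp add: l2_inner_add_scale_left fock_space_L2)
  qed
  then show ?thesis
    unfolding fock_inner_def
    using fock_inner_summable[OF assms(2,1), THEN summable_norm_cancel]
      fock_inner_summable[OF assms(3,1), THEN summable_norm_cancel]
    by (simp add: suminf_add[symmetric] suminf_mult summable_mult)
qed

lemma fock_inner_le_half_squares:
  assumes "F \<in> fock_space" "G \<in> fock_space"
  shows "cmod (fock_inner F G) \<le> (Re (fock_inner F F) + Re (fock_inner G G)) / 2"
proof -
  have "cmod (fock_inner F G) \<le> (\<Sum>n. cmod (l2_inner (config n) (F n) (G n)))"
    unfolding fock_inner_def by (rule summable_norm[OF fock_inner_summable[OF assms]])
  also have "\<dots> \<le> (\<Sum>n. ((l2_norm (config n) (F n))\<^sup>2 + (l2_norm (config n) (G n))\<^sup>2) / 2)"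
    using assms
    by (intro suminf_le fock_inner_summable l2_inner_le_half_squares fock_space_L2
        summable_divide summable_add fock_space_summable)
  also have "\<dots> = (Re (fock_inner F F) + Re (fock_inner G G)) / 2"
    using assms[THEN fock_space_summable]
    by (simp add: fock_inner_self assms suminf_divide suminf_add[symmetric] summable_add)
  finally show ?thesis .
qed

section \<open>The form \<open>expect\<close> of a Fock state\<close>

lemma fock_state_weight_nonneg: "fock_state \<rho> \<Longrightarrow> 0 \<le> weight \<rho> j"
  by (simp add: fock_state_def density_matrix_def)

lemma fock_state_annihilate:
  "fock_state \<rho> \<Longrightarrow> f \<in> L2 lborel \<Longrightarrow> weight \<rho> j \<noteq> 0 \<Longrightarrow> annihilate f (eigvec \<rho> j) \<in> fock_space"
  using fock_state_weight_nonneg[of \<rho> j] unfolding fock_state_def by auto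

lemma expect_summable:
  assumes "fock_state \<rho>" "f \<in> L2 lborel" "g \<in> L2 lborel"
  shows "summable (\<lambda>j. complex_of_real (weight \<rho> j) *
     fock_inner (annihilate f (eigvec \<rho> j)) (annihilate g (eigvec \<rho> j)))"
proof (rule summable_comparison_test')
  let ?E = "\<lambda>f j. Re (fock_inner (annihilate f (eigvec \<rho> j)) (annihilate f (eigvec \<rho> j)))"
  have "summable (\<lambda>j. weight \<rho> j * ?E f j)" "summable (\<lambda>j. weight \<rho> j * ?E g j)"
    using assms unfolding fock_state_def by auto
  then have "summable (\<lambda>j. (weight \<rho> j * ?E f j + weight \<rho> j * ?E g j) / 2)"
    by (intro summable_divide summable_add)
  then show "summable (\<lambda>j. weight \<rho> j * ((?E f j + ?E g j) / 2))"
    by (simp add: algebra_simps)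
  show "norm (complex_of_real (weight \<rho> j) *
      fock_inner (annihilate f (eigvec \<rho> j)) (annihilate g (eigvec \<rho> j)))
      \<le> weight \<rho> j * ((?E f j + ?E g j) / 2)" for j
  \<comment> \<open>An eigenvector of weight 0 need not lie in the domain of the annihilation
    operators; its term vanishes whatever value \<open>fock_inner\<close> takes there.\<close>
  proof (cases "weight \<rho> j = 0")
    case False
    then have "cmod (fock_inner (annihilate f (eigvec \<rho> j)) (annihilate g (eigvec \<rho> j)))
        \<le> (?E f j + ?E g j) / 2"
      using assms by (intro fock_inner_le_half_squares fock_state_annihilate)
    then show ?thesis
      using fock_state_weight_nonneg[OF assms(1), of j]
      by (simp only: norm_mult norm_of_real abs_of_nonneg mult_left_mono)
  qed simp
qed

text \<open>Annihilation is antilinear in the wave function and the inner product is antilinear in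
  its first entry, so the two conjugations cancel. The form is therefore linear in its first
  argument and antilinear in its second, opposite to \<open>l2_inner\<close>.\<close>

lemma expect_add_scale_left:
  assumes "fock_state \<rho>" "f \<in> L2 lborel" "g \<in> L2 lborel" "h \<in> L2 lborel"
  shows "expect \<rho> (\<lambda>y. f y + c * g y) h = expect \<rho> f h + c * expect \<rho> g h"
proof -
  define E where "E f j = complex_of_real (weight \<rho> j) *
      fock_inner (annihilate f (eigvec \<rho> j)) (annihilate h (eigvec \<rho> j))" for f j
  have "E (\<lambda>y. f y + c * g y) j = E f j + c * E g j" for j
  proof (cases "weight \<rho> j = 0")
    case False
    have "eigvec \<rho> j (Suc n) \<in> L2 (config (Suc n))" for n
      using assms(1) by (intro fock_space_L2) (simp add: fock_state_def density_matrix_def)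
    then have "fock_inner (annihilate (\<lambda>y. f y + c * g y) (eigvec \<rho> j)) (annihilate h (eigvec \<rho> j))
        = fock_inner (annihilate f (eigvec \<rho> j)) (annihilate h (eigvec \<rho> j))
          + cnj (cnj c) * fock_inner (annihilate g (eigvec \<rho> j)) (annihilate h (eigvec \<rho> j))"
      using assms False
      by (intro fock_inner_add_scale_left fock_state_annihilate annihilate_add_scale L2_add_scale)
    then show ?thesis
      unfolding E_def by (simp add: algebra_simps)
  qed (simp add: E_def)
  moreover have "summable (E f)" "summable (E g)"
    unfolding E_def using assms by (auto intro: expect_summable)
  ultimately have "(\<Sum>j. E (\<lambda>y. f y + c * g y) j) = (\<Sum>j. E f j) + c * (\<Sum>j. E g j)"
    by (simp add: suminf_add[symmetric] suminf_mult summable_mult)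
  then show ?thesis
    by (simp add: expect_def E_def)
qed

lemma expect_cnj:
  assumes "fock_state \<rho>" "f \<in> L2 lborel" "g \<in> L2 lborel"
  shows "expect \<rho> g f = cnj (expect \<rho> f g)"
proof -
  have "(\<lambda>j. complex_of_real (weight \<rho> j) *
      fock_inner (annihilate f (eigvec \<rho> j)) (annihilate g (eigvec \<rho> j))) sums expect \<rho> f g"
    unfolding expect_def by (rule summable_sums[OF expect_summable[OF assms]])
  then have "(\<lambda>j. cnj (complex_of_real (weight \<rho> j) *
      fock_inner (annihilate f (eigvec \<rho> j)) (annihilate g (eigvec \<rho> j)))) sums cnj (expect \<rho> f g)"
    by (simp only: sums_cnj)
  moreover have "cnj (complex_of_real (weight \<rho> j) *
      fock_inner (annihilate f (eigvec \<rho> j)) (annihilate g (eigvec \<rho> j)))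
      = complex_of_real (weight \<rho> j) *
      fock_inner (annihilate g (eigvec \<rho> j)) (annihilate f (eigvec \<rho> j))" for j
    using assms fock_inner_cnj[of "annihilate f (eigvec \<rho> j)" "annihilate g (eigvec \<rho> j)"]
      fock_state_annihilate[of \<rho> _ j]
    by (cases "weight \<rho> j = 0") auto
  ultimately show ?thesis
    unfolding expect_def[of \<rho> g f] by (simp only: sums_unique[symmetric])
qed

lemma expect_add_scale_right:
  assumes "fock_state \<rho>" "f \<in> L2 lborel" "g \<in> L2 lborel" "h \<in> L2 lborel"
  shows "expect \<rho> h (\<lambda>y. f y + c * g y) = expect \<rho> h f + cnj c * expect \<rho> h g"
  unfolding expect_cnj[OF assms(1) L2_add_scale[OF assms(2,3)] assms(4)]
    expect_cnj[OF assms(1,2,4)] expect_cnj[OF assms(1,3,4)] expect_add_scale_left[OF assms]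
  by simp

lemma expect_self:
  assumes "fock_state \<rho>" "f \<in> L2 lborel"
  shows "expect \<rho> f f = complex_of_real (occupation \<rho> f)"
  using arg_cong[where f = Im, OF expect_cnj[OF assms assms(2)]]
  by (simp add: occupation_def complex_eq_iff)

lemma occupation_nonneg:
  assumes "fock_state \<rho>" "f \<in> L2 lborel"
  shows "0 \<le> occupation \<rho> f"
proof -
  note summ = expect_summable[OF assms assms(2)]
  have "occupation \<rho> f = (\<Sum>j. Re (complex_of_real (weight \<rho> j) *
     fock_inner (annihilate f (eigvec \<rho> j)) (annihilate f (eigvec \<rho> j))))"
    unfolding occupation_def expect_def by (rule Re_suminf[OF summ])
  also have "\<dots> \<ge> 0"
  proof (rule suminf_nonneg)
    show "0 \<le> Re (complex_of_real (weight \<rho> j) *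
        fock_inner (annihilate f (eigvec \<rho> j)) (annihilate f (eigvec \<rho> j)))" for j
      using fock_state_weight_nonneg[OF assms(1), of j] fock_state_annihilate[OF assms, of j]
        fock_inner_self_nonneg[of "annihilate f (eigvec \<rho> j)"]
      by (cases "weight \<rho> j = 0") simp_all
  qed (rule summable_Re[OF summ])
  finally show ?thesis .
qed

lemma occupation_add_scale:
  assumes "fock_state \<rho>" "f \<in> L2 lborel" "g \<in> L2 lborel"
  shows "occupation \<rho> (\<lambda>x. f x + c * g x)
      = occupation \<rho> f + 2 * Re (c * expect \<rho> g f) + (cmod c)\<^sup>2 * occupation \<rho> g"
proof -
  have "expect \<rho> (\<lambda>x. f x + c * g x) (\<lambda>x. f x + c * g x)
      = expect \<rho> f f + cnj c * expect \<rho> f g + c * (expect \<rho> g f + cnj c * expect \<rho> g g)"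
    using assms by (simp add: expect_add_scale_left expect_add_scale_right L2_add_scale)
  also have "expect \<rho> f g = cnj (expect \<rho> g f)"
    by (rule expect_cnj[OF assms(1,3,2)])
  also have "Re (expect \<rho> f f + cnj c * cnj (expect \<rho> g f) + c * (expect \<rho> g f + cnj c * expect \<rho> g g))
      = occupation \<rho> f + 2 * Re (c * expect \<rho> g f) + (cmod c)\<^sup>2 * occupation \<rho> g"
    unfolding cmod_power2 expect_self[OF assms(1,2)] expect_self[OF assms(1,3)]
    by (simp add: algebra_simps power2_eq_square)
  finally show ?thesis
    unfolding occupation_def[of \<rho> "\<lambda>x. f x + c * g x"] by simp
qed

lemma expect_Cauchy_Schwarz:
  assumes "fock_state \<rho>" "f \<in> L2 lborel" "g \<in> L2 lborel"
  shows "cmod (expect \<rho> f g) \<le> sqrt (occupation \<rho> f * occupation \<rho> g)"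
proof (rule real_le_rsqrt)
  \<comment> \<open>The scaled vector has to be \<open>f\<close>: the form is linear in its first
    argument, so the value at \<open>g\<close> plus \<open>t\<close> times \<open>f\<close> has the
    mixed term \<open>t * expect \<rho> f g\<close>.\<close>
  have "(cmod (expect \<rho> f g))\<^sup>2 \<le> occupation \<rho> g * occupation \<rho> f"
  proof (rule hermitian_form_Cauchy_Schwarz)
    show "0 \<le> occupation \<rho> g + 2 * Re (t * expect \<rho> f g) + (cmod t)\<^sup>2 * occupation \<rho> f" for t
      unfolding occupation_add_scale[OF assms(1,3,2), symmetric]
      by (rule occupation_nonneg[OF assms(1) L2_add_scale[OF assms(3,2)]])
  qed (use assms in \<open>auto intro: occupation_nonneg\<close>)
  then show "(cmod (expect \<rho> f g))\<^sup>2 \<le> occupation \<rho> f * occupation \<rho> g"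
    by (simp add: mult.commute)
qed

text \<open>The values at \<open>f + c g\<close> and \<open>f - c g\<close> add up to the right hand
  side, and the second one is nonnegative. This makes the regular functions a linear space.\<close>

lemma occupation_add_scale_le:
  assumes "fock_state \<rho>" "f \<in> L2 lborel" "g \<in> L2 lborel"
  shows "occupation \<rho> (\<lambda>x. f x + c * g x) \<le> 2 * occupation \<rho> f + 2 * (cmod c)\<^sup>2 * occupation \<rho> g"
proof -
  have "0 \<le> occupation \<rho> (\<lambda>x. f x + (- c) * g x)"
    by (rule occupation_nonneg[OF assms(1) L2_add_scale[OF assms(2,3)]])
  from this[unfolded occupation_add_scale[OF assms]] show ?thesis
    unfolding occupation_add_scale[OF assms] mult_minus_left norm_minus_cancel uminus_complex.sel
    by linarith
qed

section \<open>Fourier transform of a ball\<close>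

lemma cis_measurable [measurable]: "cis \<in> borel_measurable borel"
  by (intro borel_measurable_continuous_onI continuous_intros)

text \<open>It suffices to test on boxes. The preimage of a box is its image under the inverse
  rotation, no longer a box, but orthogonal maps preserve Lebesgue measure.\<close>

lemma lborel_distr_orthogonal:
  fixes T :: "real ^ 'n::{finite, wellorder} \<Rightarrow> real ^ 'n::{finite, wellorder}"
  assumes "orthogonal_transformation T"
  shows "distr lborel borel T = lborel"
proof (rule lborel_eqI[symmetric])
  fix l u :: "real ^ 'n::{finite, wellorder}"
  assume lu: "\<And>b. b \<in> Basis \<Longrightarrow> l \<bullet> b \<le> u \<bullet> b"
  have inv: "orthogonal_transformation (inv T)"
    by (rule orthogonal_transformation_inv[OF assms])
  have [measurable]: "T \<in> borel_measurable borel"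
    by (intro borel_measurable_continuous_onI linear_continuous_on
        linear_conv_bounded_linear[THEN iffD1] orthogonal_transformation_linear assms)
  have pre: "T -` box l u = inv T ` box l u"
    using orthogonal_transformation_bij[OF assms] by (simp add: bij_vimage_eq_inv_image)
  have meas: "T -` box l u \<in> sets lborel"
    using measurable_sets[of T borel borel "box l u"] by simp
  have "inv T ` box l u \<in> lmeasurable"
    by (rule measurable_orthogonal_image[OF inv lmeasurable_box])
  then have "emeasure lebesgue (T -` box l u) = ennreal (measure lebesgue (inv T ` box l u))"
    unfolding pre by (simp add: emeasure_eq_measure2)
  also have "measure lebesgue (inv T ` box l u) = measure lebesgue (box l u)"
    by (rule measure_orthogonal_image[OF inv lmeasurable_box])
  also have "\<dots> = (\<Prod>b\<in>Basis. (u - l) \<bullet> b)"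
    using lu by (simp add: measure_lborel_box_eq)
  finally show "emeasure (distr lborel borel T) (box l u) = (\<Prod>b\<in>Basis. (u - l) \<bullet> b)"
    using meas by (simp add: emeasure_distr)
qed simp

lemma prod_Basis_cart: "(\<Prod>b\<in>Basis. (x :: real ^ 'n::finite) \<bullet> b) = (\<Prod>i\<in>UNIV. x $ i)"
proof -
  have Basis: "(Basis :: (real ^ 'n) set) = range (\<lambda>i. axis i 1)"
    by (auto simp: Basis_vec_def)
  have "inj (\<lambda>i::'n. axis i (1::real))"
    by (auto simp: inj_def axis_eq_axis)
  then show ?thesis
    unfolding Basis by (subst prod.reindex) (simp_all add: inner_axis)
qed

text \<open>Relabelling coordinates maps boxes to boxes with the same side lengths. It carries
  integrals over an arbitrary index type with three elements to \<open>real ^ 3\<close>.\<close>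

lemma lborel_distr_reindex:
  fixes \<pi> :: "'m::finite \<Rightarrow> 'n::finite"
  assumes "bij \<pi>"
  shows "distr lborel borel (\<lambda>x :: real ^ 'n. (\<chi> i. x $ \<pi> i) :: real ^ 'm) = lborel"
proof (rule lborel_eqI[symmetric])
  fix l u :: "real ^ 'm"
  assume lu: "\<And>b. b \<in> Basis \<Longrightarrow> l \<bullet> b \<le> u \<bullet> b"
  have lu': "l $ i \<le> u $ i" for i
    using lu[of "axis i 1"] by (simp add: inner_axis)
  define l' u' :: "real ^ 'n" where "l' = (\<chi> j. l $ inv \<pi> j)" and "u' = (\<chi> j. u $ inv \<pi> j)"
  have inv: "inv \<pi> (\<pi> i) = i" "\<pi> (inv \<pi> j) = j" for i j
    using assms by (simp_all add: bij_is_inj bij_is_surj surj_f_inv_f)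
  have [measurable]: "(\<lambda>x :: real ^ 'n. (\<chi> i. x $ \<pi> i) :: real ^ 'm) \<in> borel_measurable borel"
    by (intro borel_measurable_continuous_onI continuous_intros)
  have pre: "(\<lambda>x :: real ^ 'n. (\<chi> i. x $ \<pi> i) :: real ^ 'm) -` box l u = box l' u'"
  proof (intro set_eqI)
    fix x
    have "(\<forall>i. l $ i < x $ \<pi> i \<and> x $ \<pi> i < u $ i) \<longleftrightarrow>
        (\<forall>j. l $ inv \<pi> j < x $ j \<and> x $ j < u $ inv \<pi> j)"
      using inv by metis
    then show "x \<in> (\<lambda>x :: real ^ 'n. (\<chi> i. x $ \<pi> i) :: real ^ 'm) -` box l u \<longleftrightarrow> x \<in> box l' u'"
      by (simp add: mem_box_cart l'_def u'_def)
  qed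
  have "emeasure lborel (box l' u') = ennreal (\<Prod>b\<in>Basis. (u' - l') \<bullet> b)"
    using lu' by (intro emeasure_lborel_box)
      (auto simp: Basis_vec_def inner_axis l'_def u'_def)
  also have "(\<Prod>b\<in>Basis. (u' - l') \<bullet> b) = (\<Prod>j\<in>UNIV. (u - l) $ inv \<pi> j)"
    unfolding prod_Basis_cart by (simp add: l'_def u'_def)
  also have "\<dots> = (\<Prod>i\<in>UNIV. (u - l) $ i)"
    by (rule prod.reindex_bij_betw[OF bij_imp_bij_inv[OF assms]])
  finally show "emeasure (distr lborel borel (\<lambda>x :: real ^ 'n. (\<chi> i. x $ \<pi> i) :: real ^ 'm)) (box l u)
      = (\<Prod>b\<in>Basis. (u - l) \<bullet> b)"
    unfolding prod_Basis_cart by (subst emeasure_distr) (auto simp: pre)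
qed simp

text \<open>With \<open>A\<close> arbitrary this determines how the height
  \<open>x \<bullet> e\<close> is distributed over the ball: fixing it at \<open>t\<close> leaves a
  ball of radius sqrt(R^2 - t^2) in the remaining \<open>m\<close> coordinates. Tonelli applies once
  \<open>lborel\<close> is written as the image under \<open>W\<close> of a product over the
  basis.\<close>

lemma nn_integral_cball_slice:
  fixes e :: "'a::euclidean_space"
  assumes e: "e \<in> Basis" and "0 < R" and [measurable]: "A \<in> sets borel"
  defines "m \<equiv> DIM('a) - 1"
  shows "(\<integral>\<^sup>+ x. indicator (cball 0 R) x * indicator A (x \<bullet> e) \<partial>lborel)
    = (\<integral>\<^sup>+ t. indicator A t * (indicator {-R..R} t *
         ennreal (unit_ball_vol (real m) * sqrt (R\<^sup>2 - t\<^sup>2) ^ m)) \<partial>lborel)"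
proof -
  define I where "I = Basis - {e}"
  have I [simp]: "finite I" "e \<notin> I" "card I = m" and Basis: "Basis = insert e I"
    using e by (auto simp: I_def m_def)
  have [measurable]: "cball (0::'a) R \<in> sets borel"
    by (simp add: borel_closed)
  interpret product_sigma_finite "\<lambda>_::'a. lborel :: real measure" by standard
  define W where "W f = (\<Sum>b\<in>Basis. f b *\<^sub>R b)" for f :: "'a \<Rightarrow> real"
  have [measurable]: "W \<in> borel_measurable (Pi\<^sub>M Basis (\<lambda>_. lborel))"
    unfolding W_def by measurable
  have lb: "lborel = distr (Pi\<^sub>M Basis (\<lambda>_. lborel)) borel W"
    unfolding W_def by (rule lborel_eq)
  have W_norm: "W f \<in> cball 0 R \<longleftrightarrow> sqrt ((f e)\<^sup>2 + (\<Sum>b\<in>I. (f b)\<^sup>2)) \<le> R" for f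
  proof -
    have "dist 0 (W f) = sqrt (\<Sum>b\<in>Basis. (f b)\<^sup>2)"
      unfolding W_def by (subst euclidean_dist_l2) (auto simp: L2_set_def)
    then show ?thesis by (simp add: Basis)
  qed
  have W_e: "W f \<bullet> e = f e" for f
    using e by (simp add: W_def)
  have "(\<integral>\<^sup>+ x. indicator (cball 0 R) x * indicator A (x \<bullet> e) \<partial>lborel)
      = (\<integral>\<^sup>+ f. indicator (cball 0 R) (W f) * indicator A (f e) \<partial>Pi\<^sub>M Basis (\<lambda>_. lborel))"
    unfolding lb by (subst nn_integral_distr) (simp_all add: W_e)
  also have "\<dots> = (\<integral>\<^sup>+ t. (\<integral>\<^sup>+ f. indicator (cball 0 R) (W (f(e := t))) * indicator A t
        \<partial>Pi\<^sub>M I (\<lambda>_. lborel)) \<partial>lborel)"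
  proof -
    have [measurable]: "W \<in> borel_measurable (Pi\<^sub>M (insert e I) (\<lambda>_. lborel))"
      using \<open>W \<in> borel_measurable (Pi\<^sub>M Basis (\<lambda>_. lborel))\<close> by (simp add: Basis)
    show ?thesis
      unfolding Basis by (subst product_nn_integral_insert_rev) auto
  qed
  also have "\<dots> = (\<integral>\<^sup>+ t. indicator A t * (indicator {-R..R} t *
         ennreal (unit_ball_vol (real m) * sqrt (R\<^sup>2 - t\<^sup>2) ^ m)) \<partial>lborel)"
  proof (rule nn_integral_cong_AE)
    \<comment> \<open>At these two heights the slice shrinks to a point, whereas the ball volume
      formula used below asks for a positive radius.\<close>
    have "AE t in lborel. t \<notin> {-R, R}"
      by (intro AE_not_in countable_imp_null_set_lborel) auto
    then show "AE t in lborel. (\<integral>\<^sup>+ f. indicator (cball 0 R) (W (f(e := t))) * indicator A t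
        \<partial>Pi\<^sub>M I (\<lambda>_. lborel)) = indicator A t * (indicator {-R..R} t *
         ennreal (unit_ball_vol (real m) * sqrt (R\<^sup>2 - t\<^sup>2) ^ m))"
    proof eventually_elim
      case (elim t)
      have iff: "W (f(e := t)) \<in> cball 0 R \<longleftrightarrow> sqrt (t\<^sup>2 + (\<Sum>b\<in>I. (f b)\<^sup>2)) \<le> R" for f
      proof -
        have "(\<Sum>b\<in>I. ((f(e := t)) b)\<^sup>2) = (\<Sum>b\<in>I. (f b)\<^sup>2)"
          using I by (intro sum.cong) auto
        then show ?thesis unfolding W_norm by simp
      qed
      show ?case
      proof (cases "t \<in> {-R..R}")
        case True
        then have "0 < R\<^sup>2 - t\<^sup>2"
          using elim abs_le_square_iff[of R t] \<open>0 < R\<close> by (auto simp: not_le[symmetric])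
        then have "sqrt (t\<^sup>2 + s) \<le> R \<longleftrightarrow> sqrt s \<le> sqrt (R\<^sup>2 - t\<^sup>2)" for s
          using \<open>0 < R\<close> real_sqrt_le_iff[of "t\<^sup>2 + s" "R\<^sup>2"] by auto
        then have "(\<integral>\<^sup>+ f. indicator (cball 0 R) (W (f(e := t))) \<partial>Pi\<^sub>M I (\<lambda>_. lborel))
            = (\<integral>\<^sup>+ f. indicator ({f. sqrt (\<Sum>b\<in>I. (f b)\<^sup>2) \<le> sqrt (R\<^sup>2 - t\<^sup>2)} \<inter>
                space (Pi\<^sub>M I (\<lambda>_. lborel))) f \<partial>Pi\<^sub>M I (\<lambda>_. lborel))"
          using iff by (intro nn_integral_cong) (simp add: indicator_def)
        also have "\<dots> = emeasure (Pi\<^sub>M I (\<lambda>_. lborel)) ({f. sqrt (\<Sum>b\<in>I. (f b)\<^sup>2) \<le> sqrt (R\<^sup>2 - t\<^sup>2)} \<inter>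
                space (Pi\<^sub>M I (\<lambda>_. lborel)))"
          by (rule nn_integral_indicator) measurable
        also have "\<dots> = ennreal (unit_ball_vol (real m) * sqrt (R\<^sup>2 - t\<^sup>2) ^ m)"
          using emeasure_cball_aux[of I "sqrt (R\<^sup>2 - t\<^sup>2)"] \<open>0 < R\<^sup>2 - t\<^sup>2\<close> by (simp only: I real_sqrt_gt_0_iff)
        finally show ?thesis
          using True by (cases "t \<in> A") auto
      next
        case False
        have "\<not> sqrt (t\<^sup>2 + (\<Sum>b\<in>I. (f b)\<^sup>2)) \<le> R" for f :: "'a \<Rightarrow> real"
        proof -
          have "R < \<bar>t\<bar>" using False by auto
          also have "\<dots> \<le> sqrt (t\<^sup>2 + (\<Sum>b\<in>I. (f b)\<^sup>2))"
            by (intro real_le_rsqrt) (simp add: sum_nonneg)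
          finally show ?thesis by simp
        qed
        then show ?thesis
          using False iff by (simp add: indicator_def)
      qed
    qed
  qed
  finally show ?thesis .
qed

text \<open>The preceding lemma says that the image of Lebesgue measure on the ball under the height
  has the slice volume \<open>w\<close> as its density; integrating \<open>h\<close> against both
  sides extends it to complex functions.\<close>

lemma integral_cball_slice:
  fixes e :: "'a::euclidean_space" and h :: "real \<Rightarrow> complex"
  assumes "e \<in> Basis" and "0 < R" and [measurable]: "h \<in> borel_measurable borel"
  defines "m \<equiv> DIM('a) - 1"
  shows "(LINT x:cball 0 R|lborel. h (x \<bullet> e))
    = (LINT t:{-R..R}|lborel. (unit_ball_vol (real m) * sqrt (R\<^sup>2 - t\<^sup>2) ^ m) *\<^sub>R h t)"
proof -
  have [measurable]: "cball (0::'a) R \<in> sets borel"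
    by (simp add: borel_closed)
  define w where "w t = indicator {-R..R} t * (unit_ball_vol (real m) * sqrt (R\<^sup>2 - t\<^sup>2) ^ m)" for t
  have [measurable]: "w \<in> borel_measurable borel"
    unfolding w_def by measurable
  have w_nonneg: "0 \<le> w t" for t
  proof (cases "t \<in> {-R..R}")
    case True
    then have "t\<^sup>2 \<le> R\<^sup>2" by (intro power2_le_iff_abs_le[THEN iffD2]) (use \<open>0 < R\<close> in auto)
    then show ?thesis by (simp add: w_def)
  qed (simp add: w_def)
  have eq: "distr (density lborel (\<lambda>x. indicator (cball 0 R) x)) borel (\<lambda>x::'a. x \<bullet> e)
      = density lborel (\<lambda>t. ennreal (w t))"
  proof (rule measure_eqI)
    fix A assume "A \<in> sets (distr (density lborel (\<lambda>x. indicator (cball 0 R) x)) borel (\<lambda>x::'a. x \<bullet> e))"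
    then have [measurable]: "A \<in> sets borel" by simp
    have "emeasure (distr (density lborel (\<lambda>x. indicator (cball 0 R) x)) borel (\<lambda>x::'a. x \<bullet> e)) A
        = (\<integral>\<^sup>+ x. indicator (cball 0 R) x * indicator A (x \<bullet> e) \<partial>lborel)"
      by (simp add: emeasure_distr emeasure_density indicator_def vimage_def cong: if_cong)
    also have "\<dots> = (\<integral>\<^sup>+ t. ennreal (w t) * indicator A t \<partial>lborel)"
      unfolding nn_integral_cball_slice[OF assms(1,2) \<open>A \<in> sets borel\<close>] w_def m_def
      by (intro nn_integral_cong) (simp add: indicator_def)
    also have "\<dots> = emeasure (density lborel (\<lambda>t. ennreal (w t))) A"
      by (simp add: emeasure_density)
    finally show "emeasure (distr (density lborel (\<lambda>x. indicator (cball 0 R) x)) borel (\<lambda>x::'a. x \<bullet> e)) A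
        = emeasure (density lborel (\<lambda>t. ennreal (w t))) A" .
  qed simp
  have "(LINT x:cball 0 R|lborel. h (x \<bullet> e))
      = (LINT x|density lborel (\<lambda>x. ennreal (indicator (cball 0 R) x)). h (x \<bullet> e))"
    unfolding set_lebesgue_integral_def by (subst integral_density) auto
  also have "\<dots> = (LINT t|distr (density lborel (\<lambda>x. indicator (cball 0 R) x)) borel (\<lambda>x::'a. x \<bullet> e). h t)"
    by (subst integral_distr) (simp_all add: ennreal_indicator)
  also have "\<dots> = (LINT t|lborel. w t *\<^sub>R h t)"
    unfolding eq by (subst integral_density) (auto simp: w_nonneg)
  finally show ?thesis
    unfolding set_lebesgue_integral_def w_def by simp
qed

section \<open>The integral of a plane wave over a ball in dimension 3\<close>

lemma has_integral_parabola_cis: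
  fixes a R :: real
  assumes "a \<noteq> 0" and "0 < R"
  shows "((\<lambda>t. complex_of_real (R\<^sup>2 - t\<^sup>2) * cis (t * a)) has_integral
     complex_of_real (4 * (sin (R * a) - R * a * cos (R * a)) / a ^ 3)) {-R..R}"
proof -
  \<comment> \<open>Integration by parts, repeated until the parabola is differentiated away, gives
    these three terms; the first one vanishes at both ends of the interval.\<close>
  define G :: "complex \<Rightarrow> complex" where
    "G z = - \<i> * (complex_of_real (R\<^sup>2) - z\<^sup>2) * exp (\<i> * a * z) / a
      - 2 * z * exp (\<i> * a * z) / a\<^sup>2 - 2 * \<i> * exp (\<i> * a * z) / a ^ 3" for z
  have "((\<lambda>t. complex_of_real (R\<^sup>2 - t\<^sup>2) * cis (t * a)) has_integral (G R - G (- R))) {-R..R}"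
    unfolding of_real_minus[symmetric]
  proof (rule fundamental_theorem_of_calculus)
    have deriv: "(G has_field_derivative (complex_of_real (R\<^sup>2) - z\<^sup>2) * exp (\<i> * a * z)) (at z)" for z
      unfolding G_def using \<open>a \<noteq> 0\<close>
      by (auto intro!: derivative_eq_intros simp: field_simps power2_eq_square power3_eq_cube)
    show "((\<lambda>t. G (complex_of_real t)) has_vector_derivative
        complex_of_real (R\<^sup>2 - t\<^sup>2) * cis (t * a)) (at t within {-R..R})" for t
      using has_vector_derivative_real_field[OF deriv[of "complex_of_real t"], of "{-R..R}"]
      by (simp add: cis_conv_exp mult_ac)
  qed (use \<open>0 < R\<close> in simp)
  also have "G R - G (- R) = complex_of_real (4 * (sin (R * a) - R * a * cos (R * a)) / a ^ 3)"
  proof -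
    have "exp (\<i> * a * R) = cis (R * a)" "exp (\<i> * a * (- complex_of_real R)) = cis (- (R * a))"
      unfolding cis_conv_exp by (simp_all add: mult_ac)
    then have G1: "G R = Complex (2 * sin (R * a) / a ^ 3 - 2 * R * cos (R * a) / a\<^sup>2)
          (- 2 * R * sin (R * a) / a\<^sup>2 - 2 * cos (R * a) / a ^ 3)"
      and G2: "G (- R) = Complex (- 2 * sin (R * a) / a ^ 3 + 2 * R * cos (R * a) / a\<^sup>2)
          (- 2 * R * sin (R * a) / a\<^sup>2 - 2 * cos (R * a) / a ^ 3)"
      unfolding G_def by (simp_all add: complex_eq_iff flip: of_real_power)
    show ?thesis
      unfolding G1 G2 using \<open>a \<noteq> 0\<close>
      by (simp add: complex_eq_iff field_simps power2_eq_square power3_eq_cube)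
  qed
  finally show ?thesis .
qed

lemma has_integral_mult_sin:
  assumes "0 \<le> u"
  shows "((\<lambda>r. r * sin r) has_integral (sin u - u * cos u)) {0..u :: real}"
proof -
  have "((\<lambda>r. r * sin r) has_integral ((sin u - u * cos u) - (sin 0 - 0 * cos 0))) {0..u}"
    by (rule fundamental_theorem_of_calculus[OF assms])
       (auto intro!: derivative_eq_intros simp: has_real_derivative_iff_has_vector_derivative[symmetric])
  then show ?thesis by simp
qed


lemma lborel_integral_translate:
  fixes g :: "'a::euclidean_space \<Rightarrow> complex"
  assumes "g \<in> borel_measurable borel"
  shows "(LINT z|lborel. g (z + x)) = (LINT z|lborel. g z)"
proof -
  have "(LINT z|lborel. g z) = (LINT z|distr lborel borel ((+) x). g z)"
    by (simp only: lborel_distr_plus)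
  also have "\<dots> = (LINT z|lborel. g (x + z))"
    using assms by (intro integral_distr) auto
  finally show ?thesis by (simp add: add.commute)
qed

lemma sphere_null_sets: "sphere (c :: 'a::euclidean_space) R \<in> null_sets lborel"
  using negligible_sphere[of c R]
  by (auto simp: null_sets_completion_iff negligible_iff_null_sets)

text \<open>In dimension 3 the slices are discs, whose area
  \<open>pi * (R\<^sup>2 - t\<^sup>2)\<close> is a polynomial in the height. Passing to the closed
  ball only adds a sphere of measure zero.\<close>

lemma integral_ball_cis_axis:
  fixes e :: "'a::euclidean_space"
  assumes e: "e \<in> Basis" and dim: "DIM('a) = 3" and "a \<noteq> 0" and "0 < R"
  shows "(LINT x:ball 0 R|lborel. cis (a * (x \<bullet> e)))
    = complex_of_real (4 * pi * (sin (R * a) - R * a * cos (R * a)) / a ^ 3)"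
proof -
  have [measurable]: "cball (0::'a) R \<in> sets borel" "ball (0::'a) R \<in> sets borel"
    by (simp_all add: borel_closed)
  have "(LINT x:ball 0 R|lborel. cis (a * (x \<bullet> e))) = (LINT x:cball 0 R|lborel. cis (a * (x \<bullet> e)))"
    unfolding set_lebesgue_integral_def
  proof (rule integral_cong_AE)
    show "AE x in lborel. indicat_real (ball 0 R) x *\<^sub>R cis (a * (x \<bullet> e))
        = indicat_real (cball 0 R) x *\<^sub>R cis (a * (x \<bullet> e))"
      using AE_not_in[OF sphere_null_sets[of 0 R]]
      by eventually_elim (auto simp: indicator_def)
  qed measurable
  also have "\<dots> = (LINT t:{-R..R}|lborel. (pi * (R\<^sup>2 - t\<^sup>2)) *\<^sub>R cis (a * t))"
  proof -
    have "(sqrt (R\<^sup>2 - t\<^sup>2))\<^sup>2 = R\<^sup>2 - t\<^sup>2" if "t \<in> {-R..R}" for t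
    proof -
      have "t\<^sup>2 \<le> R\<^sup>2" using that by (intro abs_le_square_iff[THEN iffD1]) auto
      then show ?thesis by simp
    qed
    then show ?thesis
      using dim by (subst integral_cball_slice[OF e \<open>0 < R\<close>])
        (auto simp: unit_ball_vol_2 intro!: set_lebesgue_integral_cong)
  qed
  also have "\<dots> = integral {-R..R} (\<lambda>t. (pi * (R\<^sup>2 - t\<^sup>2)) *\<^sub>R cis (a * t))"
    by (intro set_borel_integral_eq_integral borel_integrable_atLeastAtMost' continuous_intros)
  also have "\<dots> = complex_of_real pi * complex_of_real (4 * (sin (R * a) - R * a * cos (R * a)) / a ^ 3)"
    using has_integral_mult_right[OF has_integral_parabola_cis[OF \<open>a \<noteq> 0\<close> \<open>0 < R\<close>], of "complex_of_real pi"]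
    by (intro integral_unique) (simp add: scaleR_conv_of_real mult_ac)
  finally show ?thesis by simp
qed

text \<open>Rotation invariance of the Lebesgue measure is available only for vectors with a well-ordered
  index type, hence the detour through \<^typ>\<open>real ^ 3\<close>.\<close>

lemma integral_ball_cis:
  fixes q :: "real ^ 'n::finite"
  assumes card: "CARD('n) = 3" and "q \<noteq> 0" and "0 < R"
  shows "(LINT x:ball 0 R|lborel. cis (x \<bullet> q))
    = complex_of_real (4 * pi * (sin (R * norm q) - R * norm q * cos (R * norm q)) / norm q ^ 3)"
proof -
  obtain \<pi> :: "3 \<Rightarrow> 'n" where \<pi>: "bij \<pi>"
    using card finite_same_card_bij[of "UNIV :: 3 set" "UNIV :: 'n set"] by auto
  define P :: "real ^ 'n \<Rightarrow> real ^ 3" where "P x = (\<chi> i. x $ \<pi> i)" for x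
  have inner: "P x \<bullet> P y = x \<bullet> y" for x y
    unfolding inner_vec_def P_def by (simp add: sum.reindex_bij_betw[OF \<pi>, of "\<lambda>i. x $ i * y $ i"])
  have norm: "norm (P x) = norm x" for x
    by (simp add: norm_eq_sqrt_inner inner)
  define e :: "real ^ 3" where "e = axis 1 1"
  have e: "e \<in> Basis" by (simp add: e_def Basis_vec_def) blast
  \<comment> \<open>The rotation turns a coordinate axis into the direction of the momentum, so that
    the integrand depends on one coordinate only.\<close>
  obtain T :: "real ^ 3 \<Rightarrow> real ^ 3" where T: "orthogonal_transformation T" and Te: "T (norm q *\<^sub>R e) = P q"
    using orthogonal_transformation_exists[of "norm q *\<^sub>R e" "P q"] e by (auto simp: norm)
  have [measurable]: "P \<in> borel_measurable borel"
    unfolding P_def by (intro borel_measurable_continuous_onI continuous_intros)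
  have [measurable]: "T \<in> borel_measurable borel"
    by (intro borel_measurable_continuous_onI linear_continuous_on
        linear_conv_bounded_linear[THEN iffD1] orthogonal_transformation_linear T)
  have [measurable]: "ball (0 :: real ^ 3) R \<in> sets borel"
    by simp
  have "(LINT x:ball 0 R|lborel. cis (x \<bullet> q))
      = (LINT x|lborel. indicat_real (ball 0 R) (P x) *\<^sub>R cis (P x \<bullet> P q))"
    unfolding set_lebesgue_integral_def by (simp add: inner norm indicator_def)
  also have "\<dots> = (LINT y|distr lborel borel P. indicat_real (ball 0 R) y *\<^sub>R cis (y \<bullet> P q))"
    by (rule integral_distr[symmetric]) measurable
  \<comment> \<open>Both image measures are Lebesgue measure; exchanging them performs the rotation
    of the integration variable.\<close>
  also have "distr lborel borel P = distr lborel borel T"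
    using lborel_distr_reindex[OF \<pi>] lborel_distr_orthogonal[OF T] by (simp add: P_def[abs_def])
  also have "(LINT y|distr lborel borel T. indicat_real (ball 0 R) y *\<^sub>R cis (y \<bullet> P q))
      = (LINT y|lborel. indicat_real (ball 0 R) (T y) *\<^sub>R cis (T y \<bullet> P q))"
    by (rule integral_distr) measurable
  also have "\<dots> = (LINT y:ball 0 R|lborel. cis (norm q * (y \<bullet> e)))"
    using T unfolding set_lebesgue_integral_def
    by (simp add: Te[symmetric] orthogonal_transformation_def indicator_def orthogonal_transformation_norm[OF T])
  also have "\<dots> = complex_of_real (4 * pi * (sin (R * norm q) - R * norm q * cos (R * norm q)) / norm q ^ 3)"
    using assms by (intro integral_ball_cis_axis[OF e]) auto
  finally show ?thesis .
qed

lemma peak_profile_3: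
  assumes "0 < u"
  shows "peak_profile 3 u = (3 * (sin u - u * cos u) / u ^ 3)\<^sup>2"
proof -
  define v where "v = sin u - u * cos u"
  have "integral {0..u} (\<lambda>r. r powi (int 3 - 2) * sin r) = v"
    using has_integral_mult_sin[of u] assms unfolding v_def by (intro integral_unique) simp
  moreover have "u powi (- 2 * int 3) = 1 / (u ^ 3)\<^sup>2"
    by (simp add: power_int_minus inverse_eq_divide flip: power_mult)
  ultimately show ?thesis
    unfolding peak_profile_def v_def[symmetric] using assms
    by (simp add: power_divide power_mult_distrib)
qed

lemma form_factor_zero:
  assumes "U \<in> sets lborel" and "emeasure lborel U < \<infinity>" and "0 < measure lborel U"
  shows "form_factor U 0 = 1"
proof -
  have "(LINT x:U|lborel. 1 :: complex) = complex_of_real (measure lborel U)"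
    using assms(1,2) unfolding set_lebesgue_integral_def
    by (subst Bochner_Integration.integral_scaleR_left) (auto simp: scaleR_conv_of_real)
  then show ?thesis
    using assms(3) by (simp add: form_factor_def)
qed

text \<open>Moving the centre to the origin costs a phase, which the modulus ignores. Both sides
  then become the square of 3 (sin u - u cos u) / u^3 with u = R |q|, and both are 1 at
  \<open>q = 0\<close>.\<close>

lemma form_factor_ball_3:
  fixes q :: "real ^ 'n::finite"
  assumes card: "CARD('n) = 3" and R: "0 < R"
  shows "form_factor (ball c R) q = peak_profile 3 (R * norm q)"
proof (cases "q = 0")
  case True
  then show ?thesis
    using R form_factor_zero[of "ball c R"] emeasure_lborel_ball_finite[of c R]
    by (simp add: peak_profile_def)
next
  case False
  have [measurable]: "ball c R \<in> sets borel"
    by simp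
  define u where "u = R * norm q"
  have u: "0 < u" using False R by (simp add: u_def)
  have "(LINT x:ball c R|lborel. cis (x \<bullet> q))
      = (LINT x|lborel. indicat_real (ball c R) (x + c) *\<^sub>R cis ((x + c) \<bullet> q))"
    unfolding set_lebesgue_integral_def
    by (rule lborel_integral_translate[symmetric]) measurable
  also have "\<dots> = (LINT x|lborel. cis (c \<bullet> q) * (indicat_real (ball 0 R) x *\<^sub>R cis (x \<bullet> q)))"
    by (intro Bochner_Integration.integral_cong)
      (auto simp: inner_add_left cis_mult[symmetric] indicator_def dist_norm norm_minus_commute)
  also have "\<dots> = cis (c \<bullet> q) * (LINT x:ball 0 R|lborel. cis (x \<bullet> q))"
    unfolding set_lebesgue_integral_def by (rule integral_mult_right_zero)
  also have "(cmod \<dots>)\<^sup>2 = (4 * pi * (sin u - u * cos u) / norm q ^ 3)\<^sup>2"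
    unfolding integral_ball_cis[OF card False R] norm_mult norm_cis norm_of_real u_def
    by (simp only: power2_abs mult_1)
  finally have "form_factor (ball c R) q
      = (4 * pi * (sin u - u * cos u) / norm q ^ 3 / measure lborel (ball c R))\<^sup>2"
    unfolding form_factor_def by (simp add: norm_divide power_divide power_mult_distrib)
  also have "measure lborel (ball c R) = 4 / 3 * pi * R ^ 3"
    using R card by (simp add: content_ball unit_ball_vol_3)
  also have "4 * pi * (sin u - u * cos u) / norm q ^ 3 / (4 / 3 * pi * R ^ 3) = 3 * (sin u - u * cos u) / u ^ 3"
    using R False by (simp add: u_def field_simps power_mult_distrib)
  finally show ?thesis
    using peak_profile_3[OF u] by (simp add: u_def)
qed

section \<open>Condensates\<close>

lemma L2_on_L2: "f \<in> L2_on U \<Longrightarrow> f \<in> L2 lborel"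
  by (simp add: L2_on_def)

lemma L2_on_AE: "f \<in> L2_on U \<Longrightarrow> AE x in lborel. x \<notin> U \<longrightarrow> f x = 0"
  by (simp add: L2_on_def)

lemma L2_on_add_scale:
  assumes "f \<in> L2_on U" "g \<in> L2_on U"
  shows "(\<lambda>x. f x + c * g x) \<in> L2_on U"
proof -
  have "AE x in lborel. x \<notin> U \<longrightarrow> f x + c * g x = 0"
    using assms[THEN L2_on_AE] by eventually_elim auto
  then show ?thesis
    using L2_add_scale[of f lborel g c] assms by (simp add: L2_on_def)
qed

lemma L2_on_mono: "V \<subseteq> U \<Longrightarrow> L2_on V \<subseteq> L2_on U"
  by (auto simp: L2_on_def elim: AE_mp)

text \<open>The closedness built into a proper condensate concerns limits inside
  \<open>L2_on U\<close>, whereas the projection takes limits in all of L2. This bridges the two: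
  the squared norm of \<open>f\<close> outside \<open>U\<close> is bounded by its squared distance
  to every \<open>F k\<close>.\<close>

lemma L2_on_limit:
  assumes U: "U \<in> sets lborel" and F: "\<And>k. F k \<in> L2_on U" and f: "f \<in> L2 lborel"
    and lim: "(\<lambda>k::nat. l2_norm lborel (\<lambda>x. F k x - f x)) \<longlonglongrightarrow> 0"
  shows "f \<in> L2_on U"
proof -
  note [measurable] = L2_measurable[OF f] U
  define g where "g x = indicator (- U) x * (cmod (f x))\<^sup>2" for x
  have Fk: "(\<lambda>x. F k x - f x) \<in> L2 lborel" for k
    by (intro L2_diff L2_on_L2[OF F] f)
  have [measurable]: "g \<in> borel_measurable lborel"
    unfolding g_def by measurable
  have g: "integrable lborel g"
    by (rule Bochner_Integration.integrable_bound[OF L2_square_integrable[OF f]])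
       (auto simp: g_def indicator_def)
  have le: "(LINT x|lborel. g x) \<le> (l2_norm lborel (\<lambda>x. F k x - f x))\<^sup>2" for k
    unfolding l2_norm_square
  proof (rule integral_mono_AE[OF g L2_square_integrable[OF Fk]])
    show "AE x in lborel. g x \<le> (cmod (F k x - f x))\<^sup>2"
      using L2_on_AE[OF F[of k]] by eventually_elim (auto simp: g_def indicator_def)
  qed
  have "(\<lambda>k. (l2_norm lborel (\<lambda>x. F k x - f x))\<^sup>2) \<longlonglongrightarrow> 0"
    using tendsto_power[OF lim, of 2] by simp
  then have "(LINT x|lborel. g x) \<le> 0"
    by (rule LIMSEQ_le_const) (use le in blast)
  moreover have nonneg: "0 \<le> g x" for x
    by (simp add: g_def)
  ultimately have "(LINT x|lborel. g x) = 0"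
    by (intro antisym integral_nonneg_AE) auto
  then have "AE x in lborel. g x = 0"
    using integral_nonneg_eq_0_iff_AE[OF g AE_I2] nonneg by simp
  then have "AE x in lborel. x \<notin> U \<longrightarrow> f x = 0"
    by eventually_elim (auto simp: g_def)
  then show ?thesis
    using f by (simp add: L2_on_def)
qed

text \<open>An eventual real bound can be added and scaled, unlike the extended real limsup.\<close>

lemma regular_subspace_iff:
  "f \<in> regular_subspace \<omega> U \<longleftrightarrow>
     f \<in> L2_on U \<and> (\<exists>M. \<forall>\<^sub>F \<sigma> in at_top. occupation (\<omega> \<sigma>) f \<le> M)"
proof -
  have "Limsup at_top (\<lambda>\<sigma>. ereal (occupation (\<omega> \<sigma>) f)) < \<infinity> \<longleftrightarrow>
      (\<exists>M. \<forall>\<^sub>F \<sigma> in at_top. occupation (\<omega> \<sigma>) f \<le> M)"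
  proof
    assume "Limsup at_top (\<lambda>\<sigma>. ereal (occupation (\<omega> \<sigma>) f)) < \<infinity>"
    then obtain M where "Limsup at_top (\<lambda>\<sigma>. ereal (occupation (\<omega> \<sigma>) f)) < ereal M"
      using ereal_dense2[of "Limsup at_top (\<lambda>\<sigma>. ereal (occupation (\<omega> \<sigma>) f))" \<infinity>] by blast
    from Limsup_lessD[OF this] have "\<forall>\<^sub>F \<sigma> in at_top. occupation (\<omega> \<sigma>) f \<le> M"
      by eventually_elim simp
    then show "\<exists>M. \<forall>\<^sub>F \<sigma> in at_top. occupation (\<omega> \<sigma>) f \<le> M" by blast
  next
    assume "\<exists>M. \<forall>\<^sub>F \<sigma> in at_top. occupation (\<omega> \<sigma>) f \<le> M"
    then obtain M where "\<forall>\<^sub>F \<sigma> in at_top. occupation (\<omega> \<sigma>) f \<le> M" by blast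
    then have "Limsup at_top (\<lambda>\<sigma>. ereal (occupation (\<omega> \<sigma>) f)) \<le> ereal M"
      by (intro Limsup_bounded) simp
    then show "Limsup at_top (\<lambda>\<sigma>. ereal (occupation (\<omega> \<sigma>) f)) < \<infinity>"
      by (rule le_less_trans) simp
  qed
  then show ?thesis
    by (simp add: regular_subspace_def)
qed

lemma regular_subspace_add_scale:
  assumes \<omega>: "\<And>\<sigma>. \<sigma> > 0 \<Longrightarrow> fock_state (\<omega> \<sigma>)"
    and f: "f \<in> regular_subspace \<omega> U" and g: "g \<in> regular_subspace \<omega> U"
  shows "(\<lambda>x. f x + c * g x) \<in> regular_subspace \<omega> U"
proof -
  obtain M where M: "\<forall>\<^sub>F \<sigma> in at_top. occupation (\<omega> \<sigma>) f \<le> M"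
    using f by (auto simp: regular_subspace_iff)
  obtain N where N: "\<forall>\<^sub>F \<sigma> in at_top. occupation (\<omega> \<sigma>) g \<le> N"
    using g by (auto simp: regular_subspace_iff)
  have L: "f \<in> L2_on U" "g \<in> L2_on U"
    using f g by (auto simp: regular_subspace_iff)
  have "\<forall>\<^sub>F \<sigma> in at_top. occupation (\<omega> \<sigma>) (\<lambda>x. f x + c * g x) \<le> 2 * M + 2 * (cmod c)\<^sup>2 * N"
    using M N eventually_gt_at_top[of 0]
  proof eventually_elim
    case (elim \<sigma>)
    have "occupation (\<omega> \<sigma>) (\<lambda>x. f x + c * g x)
        \<le> 2 * occupation (\<omega> \<sigma>) f + 2 * (cmod c)\<^sup>2 * occupation (\<omega> \<sigma>) g"
      using elim(3) by (intro occupation_add_scale_le \<omega> L[THEN L2_on_L2])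
    also have "\<dots> \<le> 2 * M + 2 * (cmod c)\<^sup>2 * N"
      using elim by (intro add_mono mult_left_mono) auto
    finally show ?case .
  qed
  then show ?thesis
    using L2_on_add_scale[OF L] by (auto simp: regular_subspace_iff)
qed

lemma proper_condensate_L2: "proper_condensate \<omega> U s \<Longrightarrow> s \<in> L2_on U"
  by (simp add: proper_condensate_def)

lemma proper_condensate_norm: "proper_condensate \<omega> U s \<Longrightarrow> l2_norm lborel s = 1"
  by (simp add: proper_condensate_def)

text \<open>The projection of \<open>h\<close> onto the regular subspace differs from \<open>h\<close> by a multiple of \<open>s\<close>; both
  are orthogonal to \<open>s\<close>, hence so is the multiple, which therefore vanishes.\<close>

lemma regular_if_orthogonal:
  assumes \<omega>: "\<And>\<sigma>. \<sigma> > 0 \<Longrightarrow> fock_state (\<omega> \<sigma>)" and U: "U \<in> sets lborel"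
    and pc: "proper_condensate \<omega> U s" and h: "h \<in> L2_on U" and orth: "l2_inner lborel s h = 0"
  shows "h \<in> regular_subspace \<omega> U"
proof -
  let ?R = "regular_subspace \<omega> U"
  have s: "s \<in> L2 lborel" and s1: "l2_norm lborel s = 1"
    using proper_condensate_L2[OF pc] proper_condensate_norm[OF pc] by (auto intro: L2_on_L2)
  have RU: "f \<in> L2_on U" if "f \<in> ?R" for f
    using that by (simp add: regular_subspace_iff)
  have complement: "orth_complement (L2_on U) ?R = {g \<in> L2 lborel. \<exists>c. AE x in lborel. g x = c * s x}"
    using pc by (simp add: proper_condensate_def)
  have closed: "f \<in> ?R" if "\<And>k. F k \<in> ?R" "f \<in> L2 lborel"
    "(\<lambda>k::nat. l2_norm lborel (\<lambda>x. F k x - f x)) \<longlonglongrightarrow> 0" for F f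
  proof -
    have "f \<in> L2_on U"
      using L2_on_limit[OF U RU[OF that(1)] that(2,3)] .
    then show ?thesis
      using pc that unfolding proper_condensate_def l2_closed_in_def by blast
  qed
  have zero: "(\<lambda>x. 0) \<in> ?R"
  proof -
    have "occupation (\<omega> \<sigma>) (\<lambda>x. 0) = 0" if "\<sigma> > 0" for \<sigma>
      using expect_add_scale_left[OF \<omega>[OF that] s s s, of "-1"]
        expect_add_scale_left[OF \<omega>[OF that] s s L2_zero, of "-1"] by (simp add: occupation_def)
    then have "\<forall>\<^sub>F \<sigma> in at_top. occupation (\<omega> \<sigma>) (\<lambda>x. 0) \<le> 0"
      by (intro eventually_mono[OF eventually_gt_at_top[of 0]]) simp
    then show ?thesis
      by (auto simp: regular_subspace_iff L2_on_def L2_zero)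
  qed
  have sub: "?R \<subseteq> L2 lborel"
    using RU L2_on_L2 by blast
  have "\<exists>r\<in>?R. \<forall>g\<in>?R. l2_inner lborel g (\<lambda>x. h x - r x) = 0"
  proof (rule l2_projection[of ?R lborel h])
    show "(\<lambda>x. f x + c * g x) \<in> ?R" if "f \<in> ?R" "g \<in> ?R" for f g c
      by (rule regular_subspace_add_scale[OF \<omega> that])
    show "f \<in> ?R" if "\<And>k. F k \<in> ?R" "f \<in> L2 lborel"
      "(\<lambda>k::nat. l2_norm lborel (\<lambda>x. F k x - f x)) \<longlonglongrightarrow> 0" for F f
      by (rule closed[OF that])
    show "\<exists>r\<in>?R. \<forall>g\<in>?R. l2_inner lborel g (\<lambda>x. h x - r x) = 0"
      if "r \<in> ?R" "\<And>g. g \<in> ?R \<Longrightarrow> l2_inner lborel g (\<lambda>x. h x - r x) = 0" for r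
      using that by blast
  qed (rule sub zero L2_on_L2[OF h])+
  then obtain r where r: "r \<in> ?R" and proj: "\<And>g. g \<in> ?R \<Longrightarrow> l2_inner lborel g (\<lambda>x. h x - r x) = 0"
    by blast
  have rL: "r \<in> L2 lborel" and hL: "h \<in> L2 lborel"
    using r h RU L2_on_L2 by auto
  have "(\<lambda>x. h x - r x) \<in> orth_complement (L2_on U) ?R"
    using L2_on_add_scale[OF h RU[OF r], of "-1"] proj by (simp add: orth_complement_def)
  then obtain c where c: "AE x in lborel. h x - r x = c * s x"
    unfolding complement by blast
  have "s \<in> orth_complement (L2_on U) ?R"
    unfolding complement using s by (auto intro!: exI[of _ 1])
  then have "l2_inner lborel s r = 0"
    using r by (subst l2_inner_cnj) (auto simp: orth_complement_def)
  then have "l2_inner lborel s (\<lambda>x. h x - r x) = 0"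
    using orth by (simp add: l2_inner_diff_right s rL hL)
  moreover have "l2_inner lborel s (\<lambda>x. h x - r x) = l2_inner lborel s (\<lambda>x. c * s x)"
    using c by (intro l2_inner_cong_AE s L2_diff hL rL L2_scale) auto
  moreover have "l2_inner lborel s (\<lambda>x. c * s x) = c"
    using l2_inner_add_scale_right[OF s L2_zero s, of c]
    by (simp add: l2_inner_self s1) (simp add: l2_inner_def)
  ultimately have "AE x in lborel. (cmod (r x - h x))\<^sup>2 = 0"
    using c by (auto elim!: eventually_mono)
  then have "l2_norm lborel (\<lambda>x. r x - h x) = 0"
    by (simp add: l2_norm_def integral_eq_zero_AE)
  \<comment> \<open>So far \<open>h\<close> equals the regular function \<open>r\<close> only almost
    everywhere. The constant sequence \<open>r\<close> converges to \<open>h\<close> in norm, and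
    closedness makes \<open>h\<close> itself regular.\<close>
  then show ?thesis
    using closed[of "\<lambda>_. r" h] r hL by simp
qed

lemma l2_norm_remainder_square:
  assumes "s \<in> L2 M" "f \<in> L2 M" and "l2_norm M s = 1"
  shows "(l2_norm M (\<lambda>x. f x + (- l2_inner M s f) * s x))\<^sup>2 = (l2_norm M f)\<^sup>2 - (cmod (l2_inner M s f))\<^sup>2"
proof -
  have "Re ((- l2_inner M s f) * l2_inner M f s) = - (cmod (l2_inner M s f))\<^sup>2"
    unfolding l2_inner_cnj[of M f s] cmod_power2 by (simp add: power2_eq_square)
  then show ?thesis
    unfolding l2_norm_add_scale_square[OF assms(2,1)] assms(3) by simp
qed

lemma remainder_regular:
  assumes \<omega>: "\<And>\<sigma>. \<sigma> > 0 \<Longrightarrow> fock_state (\<omega> \<sigma>)" and U: "U \<in> sets lborel"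
    and pc: "proper_condensate \<omega> U s" and f: "f \<in> L2_on U"
  shows "(\<lambda>x. f x + (- l2_inner lborel s f) * s x) \<in> regular_subspace \<omega> U"
proof (rule regular_if_orthogonal[OF \<omega> U pc])
  show "(\<lambda>x. f x + (- l2_inner lborel s f) * s x) \<in> L2_on U"
    by (intro L2_on_add_scale f proper_condensate_L2[OF pc])
  have L: "s \<in> L2 lborel" "f \<in> L2 lborel"
    using f proper_condensate_L2[OF pc] by (auto intro: L2_on_L2)
  show "l2_inner lborel s (\<lambda>x. f x + (- l2_inner lborel s f) * s x) = 0"
    unfolding l2_inner_add_scale_right[OF L(1,2,1)] l2_inner_self proper_condensate_norm[OF pc]
    by simp
qed

text \<open>The parameter \<open>b\<close> has two tasks: it bounds the overlaps with
  \<open>s\<close> in the mixed terms, and through the last hypothesis it makes the regular-regular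
  term no larger than those. It will be sqrt(|V| / |U|) for translates of a small region and 1 for
  plane waves.\<close>

lemma expect_condensate_estimate:
  assumes \<omega>: "\<And>\<sigma>. \<sigma> > 0 \<Longrightarrow> fock_state (\<omega> \<sigma>)" and U: "U \<in> sets lborel"
    and pc: "proper_condensate \<omega> U s" and bound: "regular_occupation_bound \<omega> U nR"
    and nR: "0 \<le> nR" and "\<sigma> > 0"
    and f: "f \<in> L2_on U" "l2_norm lborel f = 1" "cmod (l2_inner lborel s f) \<le> b"
    and g: "g \<in> L2_on U" "l2_norm lborel g = 1" "cmod (l2_inner lborel s g) \<le> b"
    and nC: "nR \<le> b\<^sup>2 * condensate_number \<omega> s \<sigma>"
  shows "cmod (expect (\<omega> \<sigma>) f g - complex_of_real (condensate_number \<omega> s \<sigma>) *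
      (l2_inner lborel s f * cnj (l2_inner lborel s g))) \<le> 3 * (b * sqrt (nR * condensate_number \<omega> s \<sigma>))"
proof -
  let ?\<rho> = "\<omega> \<sigma>" and ?n = "condensate_number \<omega> s \<sigma>"
  have \<rho>: "fock_state ?\<rho>" by (rule \<omega>[OF \<open>\<sigma> > 0\<close>])
  have s: "s \<in> L2 lborel" by (rule L2_on_L2[OF proper_condensate_L2[OF pc]])
  have b: "0 \<le> b" using f(3) norm_ge_zero order_trans by blast
  have n: "0 \<le> ?n" unfolding condensate_number_def by (rule occupation_nonneg[OF \<rho> s])
  \<comment> \<open>By Pythagoras, removing the component along \<open>s\<close> does not increase
    the norm; with \<open>nR\<close> nonnegative, the occupation bound then applies with norm
    1.\<close>
  have remainder: "occupation ?\<rho> (\<lambda>x. h x + (- l2_inner lborel s h) * s x) \<le> nR"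
    if "h \<in> L2_on U" "l2_norm lborel h = 1" for h
  proof -
    have "occupation ?\<rho> (\<lambda>x. h x + (- l2_inner lborel s h) * s x)
        \<le> nR * (l2_norm lborel (\<lambda>x. h x + (- l2_inner lborel s h) * s x))\<^sup>2"
      using bound remainder_regular[OF \<omega> U pc that(1)] \<open>\<sigma> > 0\<close>
      unfolding regular_occupation_bound_def by blast
    also have "\<dots> \<le> nR * 1"
      unfolding l2_norm_remainder_square[OF s L2_on_L2[OF that(1)] proper_condensate_norm[OF pc]] that(2)
      by (intro mult_left_mono nR) simp
    finally show ?thesis by simp
  qed
  define \<alpha> \<beta> where "\<alpha> = l2_inner lborel s f" and "\<beta> = l2_inner lborel s g"
  define u v where "u = (\<lambda>x. f x + (- \<alpha>) * s x)" and "v = (\<lambda>x. g x + (- \<beta>) * s x)"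
  have u: "u \<in> L2 lborel" and v: "v \<in> L2 lborel"
    unfolding u_def v_def using f g s by (simp_all only: L2_add_scale L2_on_L2)
  have occ: "occupation ?\<rho> u \<le> nR" "occupation ?\<rho> v \<le> nR"
    unfolding u_def v_def \<alpha>_def \<beta>_def using remainder f g by blast+
  have "f = (\<lambda>x. u x + \<alpha> * s x)" "g = (\<lambda>x. v x + \<beta> * s x)"
    by (simp_all add: u_def v_def)
  then have "expect ?\<rho> f g = expect ?\<rho> u v + cnj \<beta> * expect ?\<rho> u s + \<alpha> * (expect ?\<rho> s v + cnj \<beta> * expect ?\<rho> s s)"
    by (simp add: expect_add_scale_left[OF \<rho> u s] expect_add_scale_right[OF \<rho> v s] L2_add_scale u v s)
  then have split: "expect ?\<rho> f g - ?n * (\<alpha> * cnj \<beta>)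
      = expect ?\<rho> u v + cnj \<beta> * expect ?\<rho> u s + \<alpha> * expect ?\<rho> s v"
    unfolding expect_self[OF \<rho> s] condensate_number_def by (simp add: algebra_simps)
  have "cmod (expect ?\<rho> u v) \<le> sqrt (occupation ?\<rho> u * occupation ?\<rho> v)"
    by (rule expect_Cauchy_Schwarz[OF \<rho> u v])
  also have "\<dots> \<le> sqrt (nR * nR)"
    by (intro real_sqrt_le_mono mult_mono occ occupation_nonneg[OF \<rho>] v nR)
  \<comment> \<open>Here the threshold on the condensate number enters.\<close>
  also have "\<dots> \<le> sqrt (b\<^sup>2 * (nR * ?n))"
    using mult_left_mono[OF nC nR] by (intro real_sqrt_le_mono) (simp add: mult_ac)
  also have "\<dots> = b * sqrt (nR * ?n)"
    using b by (simp add: real_sqrt_mult)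
  finally have 1: "cmod (expect ?\<rho> u v) \<le> b * sqrt (nR * ?n)" .
  have "cmod (expect ?\<rho> u s) \<le> sqrt (occupation ?\<rho> u * ?n)"
    unfolding condensate_number_def by (rule expect_Cauchy_Schwarz[OF \<rho> u s])
  also have "\<dots> \<le> sqrt (nR * ?n)"
    by (intro real_sqrt_le_mono mult_right_mono occ n)
  finally have 2: "cmod (cnj \<beta> * expect ?\<rho> u s) \<le> b * sqrt (nR * ?n)"
    unfolding norm_mult complex_mod_cnj \<beta>_def by (intro mult_mono g b) auto
  have "cmod (expect ?\<rho> s v) \<le> sqrt (?n * occupation ?\<rho> v)"
    unfolding condensate_number_def by (rule expect_Cauchy_Schwarz[OF \<rho> s v])
  also have "\<dots> \<le> sqrt (?n * nR)"
    by (intro real_sqrt_le_mono mult_left_mono occ n)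
  also have "\<dots> = sqrt (nR * ?n)" by (simp add: mult.commute)
  finally have 3: "cmod (\<alpha> * expect ?\<rho> s v) \<le> b * sqrt (nR * ?n)"
    unfolding norm_mult \<alpha>_def by (intro mult_mono f b) auto
  have "cmod (expect ?\<rho> u v + cnj \<beta> * expect ?\<rho> u s + \<alpha> * expect ?\<rho> s v)
      \<le> cmod (expect ?\<rho> u v) + cmod (cnj \<beta> * expect ?\<rho> u s) + cmod (\<alpha> * expect ?\<rho> s v)"
    by (rule order_trans[OF norm_triangle_ineq add_right_mono[OF norm_triangle_ineq]])
  then have "cmod (expect ?\<rho> f g - ?n * (\<alpha> * cnj \<beta>)) \<le> 3 * (b * sqrt (nR * ?n))"
    unfolding split using 1 2 3 by linarith
  then show ?thesis unfolding \<alpha>_def \<beta>_def .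
qed

section \<open>Plane waves\<close>

text \<open>The free coefficient \<open>a\<close> covers both the normalised plane wave and the bare
  phase on a smaller set.\<close>

lemma indicator_cis_L2:
  assumes U: "U \<in> sets lborel" "emeasure lborel U < \<infinity>"
  shows "(\<lambda>z. a * (indicator U z * cis (z \<bullet> k))) \<in> L2_on U"
    and "l2_norm lborel (\<lambda>z. a * (indicator U z * cis (z \<bullet> k))) = cmod a * sqrt (measure lborel U)"
proof -
  note [measurable] = U(1)
  have sq: "(cmod (a * (indicator U z * cis (z \<bullet> k))))\<^sup>2 = (cmod a)\<^sup>2 * indicator U z" for z
    by (simp add: norm_mult indicator_def)
  show "(\<lambda>z. a * (indicator U z * cis (z \<bullet> k))) \<in> L2_on U"
    using U unfolding L2_on_def L2_def mem_Collect_eq sq by simp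
  show "l2_norm lborel (\<lambda>z. a * (indicator U z * cis (z \<bullet> k))) = cmod a * sqrt (measure lborel U)"
    unfolding l2_norm_def sq using U by (simp add: real_sqrt_mult)
qed

lemma plane_wave_eq:
  "plane_wave U k = (\<lambda>z. complex_of_real (1 / sqrt (measure lborel U)) * (indicator U z * cis (z \<bullet> k)))"
  by (simp add: plane_wave_def fun_eq_iff)

lemma plane_wave_L2:
  assumes U: "U \<in> sets lborel" "emeasure lborel U < \<infinity>" "0 < measure lborel U"
  shows "plane_wave U k \<in> L2_on U" and "l2_norm lborel (plane_wave U k) = 1"
  unfolding plane_wave_eq using indicator_cis_L2[OF U(1,2)] U(3)
  by (simp_all only: norm_of_real) simp

text \<open>The Fourier integral without its normalisation, which comes back as the power of
  \<open>2 * pi\<close> in the main term.\<close>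

definition phase_integral :: "real ^ 'n::finite \<Rightarrow> 'n wave \<Rightarrow> complex" where
  "phase_integral p f = (LINT z|lborel. cis (- (p \<bullet> z)) * f z)"

lemma phase_integral_translate:
  assumes "f \<in> L2 lborel"
  shows "phase_integral p (translate x f) = cis (p \<bullet> x) * phase_integral p f"
proof -
  have [measurable]: "f \<in> borel_measurable borel"
    using L2_measurable[OF assms] by simp
  have "phase_integral p (translate x f) = (LINT z|lborel. cis (p \<bullet> x) * (cis (- (p \<bullet> (z + x))) * f (z + x)))"
    unfolding phase_integral_def translate_def
    by (intro Bochner_Integration.integral_cong) (simp_all add: cis_mult inner_add_right flip: mult.assoc)
  also have "\<dots> = cis (p \<bullet> x) * (LINT z|lborel. cis (- (p \<bullet> (z + x))) * f (z + x))"
    by simp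
  also have "(LINT z|lborel. cis (- (p \<bullet> (z + x))) * f (z + x)) = phase_integral p f"
    unfolding phase_integral_def by (rule lborel_integral_translate) measurable
  finally show ?thesis .
qed

lemma phase_integral_fourier:
  "(cmod (phase_integral p f))\<^sup>2 = (2 * pi) ^ CARD('n) * (cmod (fourier f (p :: real ^ 'n::finite)))\<^sup>2"
proof -
  have "((2 * pi) powr (- real CARD('n) / 2))\<^sup>2 = (2 * pi) powr (- real CARD('n))"
    by (simp add: power2_eq_square flip: powr_add)
  also have "\<dots> = 1 / (2 * pi) ^ CARD('n)"
    by (simp add: powr_minus powr_realpow inverse_eq_divide)
  finally show ?thesis
    unfolding fourier_def phase_integral_def norm_mult norm_of_real power_mult_distrib power2_abs
    by simp
qed

text \<open>Since \<open>f\<close> vanishes off \<open>V\<close>, the phase may be cut off there,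
  and the cut-off phase has norm sqrt(|V|). This is where the volume of the small ball in the error
  comes from.\<close>

lemma phase_integral_bound:
  assumes V: "V \<in> sets lborel" "emeasure lborel V < \<infinity>" and f: "f \<in> L2_on V"
  shows "cmod (phase_integral p f) \<le> sqrt (measure lborel V) * l2_norm lborel f"
proof -
  note [measurable] = V(1) L2_measurable[OF L2_on_L2[OF f]]
  note e = indicator_cis_L2[OF V, of 1 p]
  have "phase_integral p f = l2_inner lborel (\<lambda>z. 1 * (indicator V z * cis (z \<bullet> p))) f"
    unfolding phase_integral_def l2_inner_def
  proof (rule integral_cong_AE)
    show "AE z in lborel. cis (- (p \<bullet> z)) * f z = cnj (1 * (indicator V z * cis (z \<bullet> p))) * f z"
      using L2_on_AE[OF f] by eventually_elim (auto simp: indicator_def cis_cnj inner_commute)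
  qed measurable
  also have "cmod \<dots> \<le> l2_norm lborel (\<lambda>z. 1 * (indicator V z * cis (z \<bullet> p))) * l2_norm lborel f"
    by (rule l2_Cauchy_Schwarz[OF L2_on_L2[OF e(1)] L2_on_L2[OF f]])
  finally show ?thesis unfolding e(2) by simp
qed

lemma l2_inner_condensate:
  assumes U: "U \<in> sets lborel" "emeasure lborel U < \<infinity>" "0 < measure lborel U"
    and s: "s \<in> L2 lborel" "AE x in lborel. s x = c * plane_wave U p x"
    and h: "h \<in> L2_on U"
  shows "l2_inner lborel s h = cnj c / complex_of_real (sqrt (measure lborel U)) * phase_integral p h"
proof -
  have "l2_inner lborel s h = l2_inner lborel (\<lambda>x. c * plane_wave U p x) h"
    by (intro l2_inner_cong_AE s L2_on_L2[OF h] L2_scale L2_on_L2[OF plane_wave_L2(1)[OF U]]) auto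
  also have "\<dots> = (LINT z|lborel. cnj c / complex_of_real (sqrt (measure lborel U)) * (cis (- (p \<bullet> z)) * h z))"
    unfolding l2_inner_def
  proof (rule integral_cong_AE)
    note [measurable] = U(1) L2_measurable[OF L2_on_L2[OF h]]
    show "(\<lambda>x. cnj (c * plane_wave U p x) * h x) \<in> borel_measurable lborel"
      unfolding plane_wave_eq by measurable
    show "(\<lambda>x. cnj c / complex_of_real (sqrt (measure lborel U)) * (cis (- (p \<bullet> x)) * h x))
        \<in> borel_measurable lborel"
      by measurable
    show "AE x in lborel. cnj (c * plane_wave U p x) * h x =
        cnj c / complex_of_real (sqrt (measure lborel U)) * (cis (- (p \<bullet> x)) * h x)"
      using L2_on_AE[OF h]
      by eventually_elim (auto simp: plane_wave_def cis_cnj inner_commute)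
  qed measurable
  finally show ?thesis
    unfolding phase_integral_def by simp
qed

lemma l2_inner_plane_wave_form_factor:
  assumes U: "U \<in> sets lborel" "emeasure lborel U < \<infinity>" "0 < measure lborel U"
    and s: "s \<in> L2 lborel" "AE x in lborel. s x = c * plane_wave U p x" "cmod c = 1"
  shows "(cmod (l2_inner lborel s (plane_wave U k)))\<^sup>2 = form_factor U (k - p)"
proof -
  define v where "v = measure lborel U"
  have "phase_integral p (plane_wave U k)
      = (LINT z|lborel. complex_of_real (1 / sqrt v) * (indicat_real U z *\<^sub>R cis (z \<bullet> (k - p))))"
    unfolding phase_integral_def plane_wave_eq v_def[symmetric]
    by (intro Bochner_Integration.integral_cong)
      (auto simp: indicator_def cis_mult inner_diff_right inner_commute)
  also have "\<dots> = complex_of_real (1 / sqrt v) * (LINT z:U|lborel. cis (z \<bullet> (k - p)))"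
    unfolding set_lebesgue_integral_def by (rule integral_mult_right_zero)
  finally have "cmod (l2_inner lborel s (plane_wave U k))
      = 1 / sqrt v * (1 / sqrt v) * cmod (LINT z:U|lborel. cis (z \<bullet> (k - p)))"
    unfolding l2_inner_condensate[OF U s(1,2) plane_wave_L2(1)[OF U]] v_def[symmetric]
    using s(3) U(3) by (simp add: norm_mult norm_divide v_def)
  also have "\<dots> = cmod (LINT z:U|lborel. cis (z \<bullet> (k - p))) / v"
    using U(3) by (simp add: v_def)
  finally show ?thesis
    using U(3) unfolding form_factor_def v_def by (simp add: norm_divide)
qed

lemma translate_L2_on:
  assumes f: "f \<in> L2_on V" and V: "V \<in> sets borel"
  shows "translate x f \<in> L2_on ((\<lambda>z. z - x) ` V)" and "l2_norm lborel (translate x f) = l2_norm lborel f"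
proof -
  have [measurable]: "f \<in> borel_measurable borel"
    using L2_measurable[OF L2_on_L2[OF f]] by simp
  have "integrable (distr lborel borel ((+) x)) (\<lambda>z. (cmod (f z))\<^sup>2)"
    using L2_square_integrable[OF L2_on_L2[OF f]] by (simp only: lborel_distr_plus)
  then have int: "integrable lborel (\<lambda>z. (cmod (f (x + z)))\<^sup>2)"
    by (subst (asm) integrable_distr_eq) auto
  have "AE z in distr lborel borel ((+) x). z \<notin> V \<longrightarrow> f z = 0"
    using L2_on_AE[OF f] by (simp only: lborel_distr_plus)
  then have "AE z in lborel. x + z \<notin> V \<longrightarrow> f (x + z) = 0"
    by (rule AE_distrD[rotated]) measurable
  then have "AE z in lborel. z \<notin> (\<lambda>z. z - x) ` V \<longrightarrow> f (z + x) = 0"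
    by eventually_elim (force simp: add.commute image_iff)
  then show "translate x f \<in> L2_on ((\<lambda>z. z - x) ` V)"
    using int by (simp add: L2_on_def L2_def translate_def add.commute)
  have "(LINT z|lborel. (cmod (f z))\<^sup>2) = (LINT z|distr lborel borel ((+) x). (cmod (f z))\<^sup>2)"
    by (simp only: lborel_distr_plus)
  also have "\<dots> = (LINT z|lborel. (cmod (f (x + z)))\<^sup>2)"
    by (intro integral_distr) auto
  finally show "l2_norm lborel (translate x f) = l2_norm lborel f"
    by (simp add: l2_norm_def translate_def add.commute)
qed

text \<open>The indicator function of a smaller set is not a multiple of \<open>s\<close>, so the regular subspace is
  nontrivial.\<close>

lemma regular_occupation_bound_nonneg:
  assumes \<omega>: "\<And>\<sigma>. \<sigma> > 0 \<Longrightarrow> fock_state (\<omega> \<sigma>)"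
    and pc: "proper_condensate \<omega> U s" and bound: "regular_occupation_bound \<omega> U nR"
    and p: "condensate_momentum U s p"
    and U: "U \<in> sets lborel" "emeasure lborel U < \<infinity>"
    and V: "V \<in> sets lborel" "V \<subseteq> U" "0 < measure lborel V" "measure lborel V < measure lborel U"
  shows "0 \<le> nR"
proof -
  have U0: "0 < measure lborel U" using V by simp
  have Vfin: "emeasure lborel V < \<infinity>"
    using emeasure_mono[OF V(2), of lborel] U by (auto simp: le_less_trans)
  obtain c where c: "cmod c = 1" "AE x in lborel. s x = c * plane_wave U p x"
    using p by (auto simp: condensate_momentum_def)
  have s: "s \<in> L2 lborel" by (rule L2_on_L2[OF proper_condensate_L2[OF pc]])
  define h where "h = (\<lambda>z. 1 * (indicator V z * cis (z \<bullet> p)))"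
  have hV: "h \<in> L2_on V" and hn: "l2_norm lborel h = sqrt (measure lborel V)"
    using indicator_cis_L2[OF V(1) Vfin, of 1 p] by (simp_all add: h_def)
  have hU: "h \<in> L2_on U" using hV L2_on_mono[OF V(2)] by blast
  define r where "r = (\<lambda>x. h x + (- l2_inner lborel s h) * s x)"
  have rR: "r \<in> regular_subspace \<omega> U"
    unfolding r_def by (rule remainder_regular[OF \<omega> U(1) pc hU])
  have "cmod (l2_inner lborel s h) = cmod (phase_integral p h) / sqrt (measure lborel U)"
    unfolding l2_inner_condensate[OF U U0 s c(2) hU] using c(1) by (simp add: norm_mult norm_divide)
  also have "\<dots> \<le> measure lborel V / sqrt (measure lborel U)"
    using phase_integral_bound[OF V(1) Vfin hV, of p] U0 unfolding hn by (simp add: divide_right_mono)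
  \<comment> \<open>The squared overlap is at most |V| times |V| / |U|, strictly less than |V|, the
    squared norm of \<open>h\<close>; hence the remainder \<open>r\<close> has positive
    norm.\<close>
  finally have "(cmod (l2_inner lborel s h))\<^sup>2 \<le> (measure lborel V / sqrt (measure lborel U))\<^sup>2"
    by (intro power_mono) auto
  also have "\<dots> = measure lborel V * (measure lborel V / measure lborel U)"
    using U0 by (simp add: power_divide power2_eq_square)
  also have "\<dots> < measure lborel V"
    using V U0 by (simp add: divide_simps)
  finally have pos: "0 < (l2_norm lborel r)\<^sup>2"
    unfolding r_def l2_norm_remainder_square[OF s L2_on_L2[OF hU] proper_condensate_norm[OF pc]] hn
    by simp
  \<comment> \<open>Any positive parameter would do in place of 1: a single state in which
    \<open>r\<close> has nonnegative occupation fixes the sign of \<open>nR\<close>.\<close>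
  have "0 \<le> occupation (\<omega> 1) r"
    using rR by (intro occupation_nonneg \<omega> L2_on_L2[of _ U]) (auto simp: regular_subspace_iff)
  also have "\<dots> \<le> nR * (l2_norm lborel r)\<^sup>2"
    using bound rR unfolding regular_occupation_bound_def by simp
  finally show ?thesis
    using pos by (simp add: zero_le_mult_iff)
qed

text \<open>Translating \<open>f\<close> by \<open>w\<close> multiplies its overlap with the plane
  wave \<open>s\<close> by the phase \<open>cis (p \<bullet> w)\<close> and leaves the modulus
  alone. The product of two such overlaps thus depends on the displacement through a phase only,
  which is why the correlations are undamped.\<close>

lemma off_diagonal_estimate:
  fixes U :: "(real ^ 'n::finite) set"
  assumes \<omega>: "\<And>\<sigma>. \<sigma> > 0 \<Longrightarrow> fock_state (\<omega> \<sigma>)"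
    and pc: "proper_condensate \<omega> U s" and bound: "regular_occupation_bound \<omega> U nR"
    and p: "condensate_momentum U s p"
    and U: "U \<in> sets lborel" "emeasure lborel U < \<infinity>"
    and V: "V \<in> sets lborel" "V \<subseteq> U" "0 < measure lborel V" "measure lborel V < measure lborel U"
    and "\<sigma> > 0" and dense: "nR / measure lborel V < condensate_number \<omega> s \<sigma> / measure lborel U"
    and f: "f \<in> L2_on V" "l2_norm lborel f = 1"
    and x: "(\<lambda>z. z - x) ` V \<subseteq> U" and y: "(\<lambda>z. z - y) ` V \<subseteq> U"
  shows "cmod (expect (\<omega> \<sigma>) (translate x f) (translate y f)
      - complex_of_real (condensate_number \<omega> s \<sigma> / measure lborel U) * cis ((x - y) \<bullet> p)
        * complex_of_real ((2 * pi) ^ CARD('n) * (cmod (fourier f p))\<^sup>2))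
    \<le> 3 * sqrt (nR * condensate_number \<omega> s \<sigma> * measure lborel V / measure lborel U)"
proof -
  let ?n = "condensate_number \<omega> s \<sigma>"
  define u v where "u = measure lborel U" and "v = measure lborel V"
  have uv: "0 < u" "0 < v" using V by (simp_all add: u_def v_def)
  have U0: "0 < measure lborel U" using V by simp
  have Vfin: "emeasure lborel V < \<infinity>"
    using emeasure_mono[OF V(2), of lborel] U by (auto simp: le_less_trans)
  obtain c where c: "cmod c = 1" "AE x in lborel. s x = c * plane_wave U p x"
    using p by (auto simp: condensate_momentum_def)
  have s: "s \<in> L2 lborel" by (rule L2_on_L2[OF proper_condensate_L2[OF pc]])
  have nR: "0 \<le> nR"
    by (rule regular_occupation_bound_nonneg[OF \<omega> pc bound p U V])
  define J where "J = phase_integral p f"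
  define b where "b = sqrt (v / u)"
  have trans: "translate w f \<in> L2_on U" "l2_norm lborel (translate w f) = 1"
    "l2_inner lborel s (translate w f) = cnj c / complex_of_real (sqrt u) * (cis (p \<bullet> w) * J)"
    "cmod (l2_inner lborel s (translate w f)) \<le> b" if "(\<lambda>z. z - w) ` V \<subseteq> U" for w
  proof -
    show t: "translate w f \<in> L2_on U"
      using translate_L2_on(1)[OF f(1), of w] L2_on_mono[OF that] V(1) by auto
    show "l2_norm lborel (translate w f) = 1"
      using translate_L2_on(2)[OF f(1), of w] V(1) f(2) by simp
    show eq: "l2_inner lborel s (translate w f) = cnj c / complex_of_real (sqrt u) * (cis (p \<bullet> w) * J)"
      unfolding l2_inner_condensate[OF U U0 s c(2) t] phase_integral_translate[OF L2_on_L2[OF f(1)]]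
        u_def J_def ..
    have "cmod (l2_inner lborel s (translate w f)) = cmod J / sqrt u"
      unfolding eq using c(1) uv by (simp add: norm_mult norm_divide)
    also have "\<dots> \<le> sqrt v / sqrt u"
      using phase_integral_bound[OF V(1) Vfin f(1), of p] f(2) uv
      by (intro divide_right_mono) (simp_all add: J_def v_def)
    finally show "cmod (l2_inner lborel s (translate w f)) \<le> b"
      by (simp add: b_def real_sqrt_divide)
  qed
  \<comment> \<open>The density threshold, multiplied by the volume of \<open>V\<close>.\<close>
  have "nR \<le> b\<^sup>2 * ?n"
    using dense uv by (simp add: b_def u_def[symmetric] v_def[symmetric] field_simps)
  note estimate = expect_condensate_estimate[OF \<omega> U(1) pc bound nR \<open>\<sigma> > 0\<close>
      trans(1,2,4)[OF x] trans(1,2,4)[OF y] this]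
  have "cnj c * c = 1" "J * cnj J = complex_of_real ((cmod J)\<^sup>2)"
    using complex_norm_square[of c] complex_norm_square[of J] c(1) by (simp_all add: mult.commute)
  moreover have "complex_of_real (sqrt u) * complex_of_real (sqrt u) = complex_of_real u"
    using uv by (simp flip: of_real_mult)
  moreover have "cis (p \<bullet> x) * cis (- (p \<bullet> y)) = cis ((x - y) \<bullet> p)"
    by (simp add: cis_mult inner_diff_left inner_commute[of p])
  moreover have "l2_inner lborel s (translate x f) * cnj (l2_inner lborel s (translate y f))
      = (cnj c * c) * (cis (p \<bullet> x) * cis (- (p \<bullet> y))) * (J * cnj J)
        / (complex_of_real (sqrt u) * complex_of_real (sqrt u))"
    unfolding trans(3)[OF x] trans(3)[OF y] by (simp add: cis_cnj mult_ac)
  ultimately have main: "complex_of_real ?n *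
      (l2_inner lborel s (translate x f) * cnj (l2_inner lborel s (translate y f)))
      = complex_of_real (?n / u) * cis ((x - y) \<bullet> p)
        * complex_of_real ((2 * pi) ^ CARD('n) * (cmod (fourier f p))\<^sup>2)"
    unfolding phase_integral_fourier[symmetric] J_def[symmetric] by simp
  have "b * sqrt (nR * ?n) = sqrt (nR * ?n * v / u)"
    unfolding b_def by (simp add: mult_ac flip: real_sqrt_mult)
  then show ?thesis
    using estimate unfolding main u_def v_def by simp
qed

text \<open>The general estimate with \<open>b = 1\<close>, as unit vectors overlap by at most 1; no
  smaller bound is uniform in \<open>k\<close>, because 1 is attained at
  \<open>k = p\<close>.\<close>

lemma momentum_distribution_estimate:
  assumes \<omega>: "\<And>\<sigma>. \<sigma> > 0 \<Longrightarrow> fock_state (\<omega> \<sigma>)"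
    and pc: "proper_condensate \<omega> U s" and bound: "regular_occupation_bound \<omega> U nR"
    and p: "condensate_momentum U s p"
    and U: "U \<in> sets lborel" "emeasure lborel U < \<infinity>" "0 < measure lborel U"
    and nR: "0 \<le> nR" and "\<sigma> > 0" and nC: "nR < condensate_number \<omega> s \<sigma>"
  shows "cmod (expect (\<omega> \<sigma>) (plane_wave U k) (plane_wave U k)
      - complex_of_real (condensate_number \<omega> s \<sigma> * form_factor U (k - p)))
    \<le> 3 * sqrt (nR * condensate_number \<omega> s \<sigma>)"
proof -
  obtain c where c: "cmod c = 1" "AE x in lborel. s x = c * plane_wave U p x"
    using p by (auto simp: condensate_momentum_def)
  have s: "s \<in> L2 lborel" by (rule L2_on_L2[OF proper_condensate_L2[OF pc]])
  note w = plane_wave_L2[OF U, of k]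
  have le: "cmod (l2_inner lborel s (plane_wave U k)) \<le> 1"
    using l2_Cauchy_Schwarz[OF s L2_on_L2[OF w(1)]] w(2) proper_condensate_norm[OF pc] by simp
  have "l2_inner lborel s (plane_wave U k) * cnj (l2_inner lborel s (plane_wave U k))
      = complex_of_real (form_factor U (k - p))"
    unfolding l2_inner_plane_wave_form_factor[OF U s c(2,1), symmetric] by (rule complex_norm_square[symmetric])
  then show ?thesis
    using expect_condensate_estimate[OF \<omega> U(1) pc bound nR \<open>\<sigma> > 0\<close> w le w le] nC by simp
qed

lemma translate_ball_compactly_in:
  fixes c :: "real ^ 'n::finite"
  assumes "0 < r"
  shows "(+) x ` ball c r \<Subset> ball c R \<longleftrightarrow> norm x < R - r"
proof -
  have "(+) x ` ball c r = ball (x + c) r"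
    by (rule ball_translation[symmetric])
  then show ?thesis
    using assms by (auto simp: compactly_in_def cball_subset_ball_iff dist_norm)
qed

text \<open>The constant is fixed ahead of the balls, the states and the wave functions. For the
  peak the argument yields the squared overlap of two plane waves in every dimension; the closed
  formula is added in dimension 3, where it evaluates this overlap.\<close>

theorem theorem3p2:
  shows "\<exists>C::real.
    \<forall>(c :: real ^ 'n::finite) L\<^sub>0 L \<omega> s p n\<^sub>R.
      (let U\<^sub>0 = ball c (L\<^sub>0 / 2); U = ball c (L / 2);
           n\<^sub>C = condensate_number \<omega> s;
           vol = measure lborel
       in
        0 < L\<^sub>0 \<and> 0 < L \<and> U\<^sub>0 \<Subset> U \<and>
        (\<forall>\<sigma>>0. fock_state (\<omega> \<sigma>)) \<and>
        homogeneous_proper_condensate \<omega> U s \<and>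
        condensate_momentum U s p \<and>
        regular_occupation_bound \<omega> U n\<^sub>R
        \<longrightarrow>
        (\<forall>x. (+) x ` U\<^sub>0 \<Subset> U \<longleftrightarrow> norm x < (L - L\<^sub>0) / 2) \<and>
        (\<forall>\<sigma>>0. n\<^sub>C \<sigma> / vol U > n\<^sub>R / vol U\<^sub>0 \<longrightarrow>
          (\<forall>f \<in> L2_on U\<^sub>0. l2_norm lborel f = 1 \<longrightarrow>
            (\<forall>x y. (+) x ` U\<^sub>0 \<Subset> U \<and> (+) y ` U\<^sub>0 \<Subset> U \<longrightarrow>
              norm (x - y) < L - L\<^sub>0 \<and>
              cmod (expect (\<omega> \<sigma>) (translate x f) (translate y f)
                    - complex_of_real (n\<^sub>C \<sigma> / vol U) * cis ((x - y) \<bullet> p)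
                      * complex_of_real ((2 * pi) ^ CARD('n) * (cmod (fourier f p))\<^sup>2))
                \<le> C * sqrt (n\<^sub>R * n\<^sub>C \<sigma> * vol U\<^sub>0 / vol U)))) \<and>
        (\<forall>\<sigma>>0. n\<^sub>C \<sigma> > n\<^sub>R \<longrightarrow>
          (\<forall>k. cmod (expect (\<omega> \<sigma>) (plane_wave U k) (plane_wave U k)
                    - complex_of_real (n\<^sub>C \<sigma> * form_factor U (k - p)))
                \<le> C * sqrt (n\<^sub>R * n\<^sub>C \<sigma>) \<and>
               (CARD('n) = 3 \<longrightarrow>
                 cmod (expect (\<omega> \<sigma>) (plane_wave U k) (plane_wave U k)
                    - complex_of_real (n\<^sub>C \<sigma> * peak_profile CARD('n) (L * norm (k - p) / 2)))
                \<le> C * sqrt (n\<^sub>R * n\<^sub>C \<sigma>)))))"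
proof (intro exI[of _ 3] allI, unfold Let_def, intro impI, elim conjE)
  fix c :: "real ^ 'n" and L\<^sub>0 L :: real and \<omega> :: "real \<Rightarrow> 'n density" and s :: "'n wave"
    and p :: "real ^ 'n" and n\<^sub>R :: real
  let ?V = "ball c (L\<^sub>0 / 2)" and ?U = "ball c (L / 2)"
  let ?n = "condensate_number \<omega> s"
  assume L: "0 < L\<^sub>0" "0 < L" and VU: "?V \<Subset> ?U"
    and states: "\<forall>\<sigma>>0. fock_state (\<omega> \<sigma>)"
    and homogeneous: "homogeneous_proper_condensate \<omega> ?U s"
    and p: "condensate_momentum ?U s p"
    and bound: "regular_occupation_bound \<omega> ?U n\<^sub>R"
  have \<omega>: "\<And>\<sigma>. \<sigma> > 0 \<Longrightarrow> fock_state (\<omega> \<sigma>)" using states by blast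
  have pc: "proper_condensate \<omega> ?U s"
    using homogeneous by (simp add: homogeneous_proper_condensate_def)
  have iff: "(+) x ` ?V \<Subset> ?U \<longleftrightarrow> norm x < (L - L\<^sub>0) / 2" for x
    using translate_ball_compactly_in[of "L\<^sub>0 / 2" x c "L / 2"] L by (simp add: diff_divide_distrib)
  have "L\<^sub>0 < L"
    using iff[of 0] VU by simp
  have U: "?U \<in> sets lborel" "emeasure lborel ?U < \<infinity>" "0 < measure lborel ?U"
    using L emeasure_lborel_ball_finite[of c "L / 2"] by auto
  have "measure lborel ?V < measure lborel ?U"
    using L \<open>L\<^sub>0 < L\<close> by (simp add: content_ball power_strict_mono)
  then have V: "?V \<in> sets lborel" "?V \<subseteq> ?U" "0 < measure lborel ?V" "measure lborel ?V < measure lborel ?U"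
    using L \<open>L\<^sub>0 < L\<close> by (auto simp: subset_ball)
  have nR: "0 \<le> n\<^sub>R"
    by (rule regular_occupation_bound_nonneg[OF \<omega> pc bound p U(1,2) V])
  \<comment> \<open>The function \<open>translate x f\<close> is supported in the ball shifted by
    \<open>- x\<close>, while the hypothesis speaks of the shift by \<open>x\<close>. For concentric
    balls both conditions depend on \<open>norm x\<close> only.\<close>
  have inner: "(\<lambda>z. z - x) ` ?V \<subseteq> ?U" if "(+) x ` ?V \<Subset> ?U" for x
  proof -
    have "(+) (- x) ` ?V \<Subset> ?U" using that iff[of "- x"] iff[of x] by simp
    then have "(+) (- x) ` ?V \<subseteq> ?U"
      unfolding compactly_in_def using closure_subset by blast
    then show ?thesis by (auto simp: image_subset_iff)
  qed
  have momentum: "cmod (expect (\<omega> \<sigma>) (plane_wave ?U k) (plane_wave ?U k)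
      - complex_of_real (?n \<sigma> * form_factor ?U (k - p))) \<le> 3 * sqrt (n\<^sub>R * ?n \<sigma>)"
    if "\<sigma> > 0" "n\<^sub>R < ?n \<sigma>" for \<sigma> k
    by (rule momentum_distribution_estimate[OF \<omega> pc bound p U nR that])
  have profile: "peak_profile CARD('n) (L * norm (k - p) / 2) = form_factor ?U (k - p)"
    if "CARD('n) = 3" for k
    using form_factor_ball_3[OF that, of "L / 2" c "k - p"] L that by simp
  have distance: "norm (x - y) < L - L\<^sub>0" if "(+) x ` ?V \<Subset> ?U" "(+) y ` ?V \<Subset> ?U" for x y
    using that norm_triangle_ineq4[of x y] unfolding iff by simp
  show "(\<forall>x. (+) x ` ?V \<Subset> ?U \<longleftrightarrow> norm x < (L - L\<^sub>0) / 2) \<and>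
        (\<forall>\<sigma>>0. n\<^sub>R / measure lborel ?V < ?n \<sigma> / measure lborel ?U \<longrightarrow>
          (\<forall>f \<in> L2_on ?V. l2_norm lborel f = 1 \<longrightarrow>
            (\<forall>x y. (+) x ` ?V \<Subset> ?U \<and> (+) y ` ?V \<Subset> ?U \<longrightarrow>
              norm (x - y) < L - L\<^sub>0 \<and>
              cmod (expect (\<omega> \<sigma>) (translate x f) (translate y f)
                    - complex_of_real (?n \<sigma> / measure lborel ?U) * cis ((x - y) \<bullet> p)
                      * complex_of_real ((2 * pi) ^ CARD('n) * (cmod (fourier f p))\<^sup>2))
                \<le> 3 * sqrt (n\<^sub>R * ?n \<sigma> * measure lborel ?V / measure lborel ?U)))) \<and>
        (\<forall>\<sigma>>0. n\<^sub>R < ?n \<sigma> \<longrightarrow>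
          (\<forall>k. cmod (expect (\<omega> \<sigma>) (plane_wave ?U k) (plane_wave ?U k)
                    - complex_of_real (?n \<sigma> * form_factor ?U (k - p)))
                \<le> 3 * sqrt (n\<^sub>R * ?n \<sigma>) \<and>
               (CARD('n) = 3 \<longrightarrow>
                 cmod (expect (\<omega> \<sigma>) (plane_wave ?U k) (plane_wave ?U k)
                    - complex_of_real (?n \<sigma> * peak_profile CARD('n) (L * norm (k - p) / 2)))
                \<le> 3 * sqrt (n\<^sub>R * ?n \<sigma>))))"
    (is "?geometry \<and> ?order \<and> ?peak")
  proof (intro conjI)
    show ?geometry
      using iff by blast
    show ?order
      using off_diagonal_estimate[OF \<omega> pc bound p U(1,2) V] inner distance by blast
    show ?peak
    proof (intro allI impI conjI, goal_cases)
      case (1 \<sigma> k)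
      then show ?case by (rule momentum)
    next
      case (2 \<sigma> k)
      show ?case
        unfolding profile[OF 2(3)] by (rule momentum[OF 2(1,2)])
    qed
  qed
qed

end
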